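(* Suppose the homotopy equivalence $f\colon\Gamma\to\Gamma$ satisfies the chain flare condition relative to the $f$-invariant subgraph $H\subset\Gamma$, with quasi-fixed submodule $V_{\rm qf}$. Then there is a constant $C>0$ such that for every $\xi\in V^{(2)}_{\rm qf}$ and every $k\ge0$, $$C^{-1}\|\xi\|\le\|A_{f,H}^k(\xi)\|\le C\|\xi\|.$$
   Context: Setup: $\mathbb{F}$ finitely generated free, $\Gamma$ a finite connected graph with $\pi_1(\Gamma)\cong\mathbb{F}$, $f$ a homotopy equivalence, cellular and edge-linear, $H\subset\Gamma$ a subgraph with $f(H)\subseteq H$, $\widetilde\Gamma$ the universal cover with deck action of $\mathbb{F}$, $\widetilde H$ the preimage of $H$, $\tilde f$ a fixed lift with $\tilde f(gz)=\Phi_f(g)\tilde f(z)$, $\Phi_f\in\mathrm{Aut}(\mathbb F)$. $C_1(\widetilde\Gamma;\mathbb{Q})$: finitely supported rational 1-chains $x=\sum_ex_ee$ (reversing orientation negates coefficient), $\mathrm{supp}(x)=\{e:x_e\ne0\}$; $A_f$ induced by $\tilde f$; $C_1(\widetilde\Gamma,\widetilde H;\mathbb{Q})$ chains vanishing on edges of $\widetilde H$; $\pi_H^\perp$ the projection onto it; $A_{f,H}=\pi_H^\perp\circ A_f|_{C_1(\widetilde\Gamma,\widetilde H;\mathbb Q)}$; $\|\cdot\|$ the $\ell^2$ norm on coefficients. $[u,v]$ is the 1-chain of the reduced edge-path from vertex $u$ to vertex $v$. Nielsen 1-chain: $\rho=\pi_H^\perp([u,v])$ with $\tilde f(u)=u,\tilde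 f(v)=v$, either non-geometric (NNC1: some edge $e\notin\widetilde H$ has $\rho_e=\pm1$ and $\rho_{ge}=0$ for all $g\ne1$) or geometric (GNC1: for distinct $g_1,g_2$, $\mathrm{supp}(g_1\rho)\cap\mathrm{supp}(g_2\rho)$ is empty or one edge; GNC2: each edge $e\notin\widetilde H$ is the unique common edge of $\mathrm{supp}(g_1\rho)$ and $\mathrm{supp}(g_2\rho)$ for exactly two elements $g_1,g_2$; GNC3: some non-commuting $g_1,g_2$ have $\mathrm{supp}(\rho)\cap\mathrm{supp}(g_i\rho)\ne\emptyset$). Chain flare condition relative to $H$: there are $\mathbb Q[\mathbb F]$-submodules $V_{\rm h},V_{\rm qf}$ with (CFH1) $C_1(\widetilde\Gamma,\widetilde H;\mathbb{Q})=V_{\rm h}+V_{\rm qf}$; (CFH2) constants $\lambda>1,0<\theta<1$ with $\lambda\|A_{f,H}(x)\|\le\max\{\|A^2_{f,H}(x)\|,\|x\|\}$ for all $x\in N_\theta(V_{\rm h})^\infty$, where $N_\theta(V)=\{x':\langle x,x'\rangle>\theta\|x\|\|x'\|\text{ for some }x\in V\}$ and $N^\infty$ is the set of $x'$ with $x'=A^k_{f,H}(x)$ for some $x\in N,k\ge0$ or $A^k_{f,H}(x')\in N$ for some $k\ge0$; (CFH3) if $V_{\rm qf}\ne0$ there is a Nielsen 1-chain $\rho$ with every $x\in V_{\rm qf}$ of the form $\sum_{j=1}^rq_jg_j\rho$, $q_j\in\mathbb{Q},g_j\in\mathbb F$. $L^2$ versions: $C^{(2)}_1(\widetilde\Gamma,\widetilde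 H)$ is the Hilbert space of square-summable complex 1-chains supported off $\widetilde H$ (identified with $L^2(\mathbb F)^{n_H}$, $n_H$ = number of edges of $\Gamma\setminus H$, via chosen lifts); $A_{f,H}$ extends to a bounded operator on it; for a submodule $V$, $V^{(2)}$ is the closure of the complex span of $V$. *)

theory Defs
  imports "HOL-Analysis.Analysis" "HOL-Algebra.Group"
begin

text \<open>Vertices of the universal cover have type 'v, (geometric) edges type 'e.
  Every edge carries the orientation lifted from the graph, given by src/tgt.
  An edge path is a list of pairs (e, b): b = True means e is traversed from
  src e to tgt e, b = False means it is traversed backwards.\<close>

fun walk :: "('e \<Rightarrow> 'v) \<Rightarrow> ('e \<Rightarrow> 'v) \<Rightarrow> 'v \<Rightarrow> ('e \<times> bool) list \<Rightarrow> 'v \<Rightarrow> bool" where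
  "walk src tgt u [] v = (u = v)"
| "walk src tgt u ((e, b) # p) v =
     ((if b then src e else tgt e) = u \<and> walk src tgt (if b then tgt e else src e) p v)"

definition reduced_walk :: "('e \<times> bool) list \<Rightarrow> bool" where
  "reduced_walk p \<longleftrightarrow>
     (\<forall>i. Suc i < length p \<longrightarrow>
        \<not> (fst (p ! i) = fst (p ! Suc i) \<and> snd (p ! i) \<noteq> snd (p ! Suc i)))"

definition is_tree :: "('e \<Rightarrow> 'v) \<Rightarrow> ('e \<Rightarrow> 'v) \<Rightarrow> bool" where
  "is_tree src tgt \<longleftrightarrow> (\<forall>u v. \<exists>!p. walk src tgt u p v \<and> reduced_walk p)"

definition walk_chain :: "('e \<times> bool) list \<Rightarrow> 'e \<Rightarrow> int" where
  "walk_chain p e = sum_list (map (\<lambda>(e', b). if e' = e then (if b then 1 else -1) else 0) p)"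

definition path_chain :: "('e \<Rightarrow> 'v) \<Rightarrow> ('e \<Rightarrow> 'v) \<Rightarrow> 'v \<Rightarrow> 'v \<Rightarrow> 'e \<Rightarrow> int" where
  "path_chain src tgt u v = walk_chain (THE p. walk src tgt u p v \<and> reduced_walk p)"

text \<open>Deck action of the group G (the fundamental group) on the universal cover:
  a free, orientation preserving action with finitely many orbits of vertices and
  edges (so the quotient graph is finite; G is then free of finite rank).\<close>
definition deck_action ::
  "'g monoid \<Rightarrow> ('g \<Rightarrow> 'v \<Rightarrow> 'v) \<Rightarrow> ('g \<Rightarrow> 'e \<Rightarrow> 'e) \<Rightarrow> ('e \<Rightarrow> 'v) \<Rightarrow> ('e \<Rightarrow> 'v) \<Rightarrow> bool" where
  "deck_action G act_v act_e src tgt \<longleftrightarrow>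
     group G
   \<and> (\<forall>v. act_v \<one>\<^bsub>G\<^esub> v = v) \<and> (\<forall>e. act_e \<one>\<^bsub>G\<^esub> e = e)
   \<and> (\<forall>g\<in>carrier G. \<forall>h\<in>carrier G. \<forall>v. act_v (g \<otimes>\<^bsub>G\<^esub> h) v = act_v g (act_v h v))
   \<and> (\<forall>g\<in>carrier G. \<forall>h\<in>carrier G. \<forall>e. act_e (g \<otimes>\<^bsub>G\<^esub> h) e = act_e g (act_e h e))
   \<and> (\<forall>g\<in>carrier G. \<forall>e. src (act_e g e) = act_v g (src e) \<and> tgt (act_e g e) = act_v g (tgt e))
   \<and> (\<forall>g\<in>carrier G. \<forall>v. act_v g v = v \<longrightarrow> g = \<one>\<^bsub>G\<^esub>)
   \<and> (\<exists>R. finite R \<and> (\<forall>v. \<exists>g\<in>carrier G. \<exists>w\<in>R. v = act_v g w))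
   \<and> (\<exists>R. finite R \<and> (\<forall>e. \<exists>g\<in>carrier G. \<exists>d\<in>R. e = act_e g d))"

text \<open>The standing setup: the tree, the deck action, the lift fv (on vertices) of the
  cellular edge-linear homotopy equivalence f, with f~(g z) = Phi(g) f~(z) and Phi an
  automorphism, and the preimage (HV, HE) of the f-invariant subgraph H.
  Since the cover is a tree, the image of an edge e under the edge-linear lift is an
  edge path from fv(src e) to fv(tgt e), whose 1-chain is [fv(src e), fv(tgt e)].\<close>
definition standing_setup ::
  "'g monoid \<Rightarrow> ('g \<Rightarrow> 'v \<Rightarrow> 'v) \<Rightarrow> ('g \<Rightarrow> 'e \<Rightarrow> 'e) \<Rightarrow> ('e \<Rightarrow> 'v) \<Rightarrow> ('e \<Rightarrow> 'v)
    \<Rightarrow> ('v \<Rightarrow> 'v) \<Rightarrow> ('g \<Rightarrow> 'g) \<Rightarrow> 'v set \<Rightarrow> 'e set \<Rightarrow> bool" where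
  "standing_setup G act_v act_e src tgt fv Phi HV HE \<longleftrightarrow>
     is_tree src tgt
   \<and> deck_action G act_v act_e src tgt
   \<and> Phi \<in> iso G G
   \<and> (\<forall>g\<in>carrier G. \<forall>z. fv (act_v g z) = act_v (Phi g) (fv z))
   \<and> (\<forall>e\<in>HE. src e \<in> HV \<and> tgt e \<in> HV)
   \<and> (\<forall>g\<in>carrier G. act_v g ` HV \<subseteq> HV \<and> act_e g ` HE \<subseteq> HE)
   \<and> fv ` HV \<subseteq> HV
   \<and> (\<forall>e\<in>HE. \<forall>e'. path_chain src tgt (fv (src e)) (fv (tgt e)) e' \<noteq> 0 \<longrightarrow> e' \<in> HE)"

definition supp :: "('e \<Rightarrow> 'a::zero) \<Rightarrow> 'e set" where
  "supp x = {e. x e \<noteq> 0}"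

definition chains1 :: "('e \<Rightarrow> rat) set" where
  "chains1 = {x. finite (supp x)}"

definition rel_chains :: "'e set \<Rightarrow> ('e \<Rightarrow> rat) set" where
  "rel_chains HE = {x \<in> chains1. \<forall>e\<in>HE. x e = 0}"

definition proj_H :: "'e set \<Rightarrow> ('e \<Rightarrow> rat) \<Rightarrow> ('e \<Rightarrow> rat)" where
  "proj_H HE x = (\<lambda>e. if e \<in> HE then 0 else x e)"

definition A_f :: "('e \<Rightarrow> 'v) \<Rightarrow> ('e \<Rightarrow> 'v) \<Rightarrow> ('v \<Rightarrow> 'v) \<Rightarrow> ('e \<Rightarrow> rat) \<Rightarrow> ('e \<Rightarrow> rat)" where
  "A_f src tgt fv x =
     (\<lambda>e'. \<Sum>e\<in>supp x. x e * of_int (path_chain src tgt (fv (src e)) (fv (tgt e)) e'))"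

definition A_fH :: "('e \<Rightarrow> 'v) \<Rightarrow> ('e \<Rightarrow> 'v) \<Rightarrow> ('v \<Rightarrow> 'v) \<Rightarrow> 'e set \<Rightarrow> ('e \<Rightarrow> rat) \<Rightarrow> ('e \<Rightarrow> rat)" where
  "A_fH src tgt fv HE x = proj_H HE (A_f src tgt fv x)"

text \<open>Action of g on chains: g (sum x_e e) = sum x_e (g e).\<close>
definition chain_act :: "'g monoid \<Rightarrow> ('g \<Rightarrow> 'e \<Rightarrow> 'e) \<Rightarrow> 'g \<Rightarrow> ('e \<Rightarrow> rat) \<Rightarrow> ('e \<Rightarrow> rat)" where
  "chain_act G act_e g x = (\<lambda>e. x (act_e (inv\<^bsub>G\<^esub> g) e))"

definition cnorm :: "('e \<Rightarrow> rat) \<Rightarrow> real" where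
  "cnorm x = sqrt (\<Sum>e\<in>supp x. (real_of_rat (x e))\<^sup>2)"

definition cinner :: "('e \<Rightarrow> rat) \<Rightarrow> ('e \<Rightarrow> rat) \<Rightarrow> real" where
  "cinner x y = (\<Sum>e\<in>supp x \<inter> supp y. real_of_rat (x e) * real_of_rat (y e))"

definition rel_submodule :: "'g monoid \<Rightarrow> ('g \<Rightarrow> 'e \<Rightarrow> 'e) \<Rightarrow> 'e set \<Rightarrow> ('e \<Rightarrow> rat) set \<Rightarrow> bool" where
  "rel_submodule G act_e HE V \<longleftrightarrow>
     V \<subseteq> rel_chains HE \<and> (\<lambda>_. 0) \<in> V
   \<and> (\<forall>x\<in>V. \<forall>y\<in>V. (\<lambda>e. x e + y e) \<in> V)
   \<and> (\<forall>q::rat. \<forall>x\<in>V. (\<lambda>e. q * x e) \<in> V)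
   \<and> (\<forall>g\<in>carrier G. \<forall>x\<in>V. chain_act G act_e g x \<in> V)"

definition NNC1 :: "'g monoid \<Rightarrow> ('g \<Rightarrow> 'e \<Rightarrow> 'e) \<Rightarrow> 'e set \<Rightarrow> ('e \<Rightarrow> rat) \<Rightarrow> bool" where
  "NNC1 G act_e HE \<rho> \<longleftrightarrow>
     (\<exists>e. e \<notin> HE \<and> (\<rho> e = 1 \<or> \<rho> e = -1)
        \<and> (\<forall>g\<in>carrier G. g \<noteq> \<one>\<^bsub>G\<^esub> \<longrightarrow> \<rho> (act_e g e) = 0))"

definition GNC1 :: "'g monoid \<Rightarrow> ('g \<Rightarrow> 'e \<Rightarrow> 'e) \<Rightarrow> ('e \<Rightarrow> rat) \<Rightarrow> bool" where
  "GNC1 G act_e \<rho> \<longleftrightarrow>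
     (\<forall>g1\<in>carrier G. \<forall>g2\<in>carrier G. g1 \<noteq> g2 \<longrightarrow>
        (let S = supp (chain_act G act_e g1 \<rho>) \<inter> supp (chain_act G act_e g2 \<rho>)
         in S = {} \<or> (\<exists>e. S = {e})))"

definition GNC2 :: "'g monoid \<Rightarrow> ('g \<Rightarrow> 'e \<Rightarrow> 'e) \<Rightarrow> 'e set \<Rightarrow> ('e \<Rightarrow> rat) \<Rightarrow> bool" where
  "GNC2 G act_e HE \<rho> \<longleftrightarrow>
     (\<forall>e. e \<notin> HE \<longrightarrow>
        (\<exists>g1\<in>carrier G. \<exists>g2\<in>carrier G. g1 \<noteq> g2
           \<and> {g \<in> carrier G. e \<in> supp (chain_act G act_e g \<rho>)} = {g1, g2}
           \<and> supp (chain_act G act_e g1 \<rho>) \<inter> supp (chain_act G act_e g2 \<rho>) = {e}))"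

definition GNC3 :: "'g monoid \<Rightarrow> ('g \<Rightarrow> 'e \<Rightarrow> 'e) \<Rightarrow> ('e \<Rightarrow> rat) \<Rightarrow> bool" where
  "GNC3 G act_e \<rho> \<longleftrightarrow>
     (\<exists>g1\<in>carrier G. \<exists>g2\<in>carrier G. g1 \<otimes>\<^bsub>G\<^esub> g2 \<noteq> g2 \<otimes>\<^bsub>G\<^esub> g1
        \<and> supp \<rho> \<inter> supp (chain_act G act_e g1 \<rho>) \<noteq> {}
        \<and> supp \<rho> \<inter> supp (chain_act G act_e g2 \<rho>) \<noteq> {})"

definition nielsen_chain ::
  "'g monoid \<Rightarrow> ('g \<Rightarrow> 'e \<Rightarrow> 'e) \<Rightarrow> ('e \<Rightarrow> 'v) \<Rightarrow> ('e \<Rightarrow> 'v) \<Rightarrow> ('v \<Rightarrow> 'v) \<Rightarrow> 'e set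
    \<Rightarrow> ('e \<Rightarrow> rat) \<Rightarrow> bool" where
  "nielsen_chain G act_e src tgt fv HE \<rho> \<longleftrightarrow>
     (\<exists>u v. fv u = u \<and> fv v = v
        \<and> \<rho> = proj_H HE (\<lambda>e. of_int (path_chain src tgt u v e)))
   \<and> (NNC1 G act_e HE \<rho> \<or> (GNC1 G act_e \<rho> \<and> GNC2 G act_e HE \<rho> \<and> GNC3 G act_e \<rho>))"

definition N_theta :: "'e set \<Rightarrow> real \<Rightarrow> ('e \<Rightarrow> rat) set \<Rightarrow> ('e \<Rightarrow> rat) set" where
  "N_theta HE \<theta> V =
     {x' \<in> rel_chains HE. \<exists>x\<in>V. cinner x x' > \<theta> * cnorm x * cnorm x'}"

definition N_inf :: "(('e \<Rightarrow> rat) \<Rightarrow> ('e \<Rightarrow> rat)) \<Rightarrow> 'e set \<Rightarrow> ('e \<Rightarrow> rat) set \<Rightarrow> ('e \<Rightarrow> rat) set" where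
  "N_inf A HE N =
     {x' \<in> rel_chains HE. (\<exists>x\<in>N. \<exists>k. x' = (A ^^ k) x) \<or> (\<exists>k. (A ^^ k) x' \<in> N)}"

definition chain_flare_rel ::
  "'g monoid \<Rightarrow> ('g \<Rightarrow> 'e \<Rightarrow> 'e) \<Rightarrow> ('e \<Rightarrow> 'v) \<Rightarrow> ('e \<Rightarrow> 'v) \<Rightarrow> ('v \<Rightarrow> 'v) \<Rightarrow> 'e set
    \<Rightarrow> ('e \<Rightarrow> rat) set \<Rightarrow> ('e \<Rightarrow> rat) set \<Rightarrow> bool" where
  "chain_flare_rel G act_e src tgt fv HE Vh Vqf \<longleftrightarrow>
     rel_submodule G act_e HE Vh \<and> rel_submodule G act_e HE Vqf
   \<comment> \<open>CFH1\<close>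
   \<and> rel_chains HE = {(\<lambda>e. a e + b e) | a b. a \<in> Vh \<and> b \<in> Vqf}
   \<comment> \<open>CFH2\<close>
   \<and> (\<exists>lam>1. \<exists>\<theta>. 0 < \<theta> \<and> \<theta> < 1 \<and>
        (\<forall>x\<in>N_inf (A_fH src tgt fv HE) HE (N_theta HE \<theta> Vh).
           lam * cnorm (A_fH src tgt fv HE x)
             \<le> max (cnorm ((A_fH src tgt fv HE ^^ 2) x)) (cnorm x)))
   \<comment> \<open>CFH3\<close>
   \<and> (Vqf \<noteq> {\<lambda>_. 0} \<longrightarrow>
        (\<exists>\<rho>. nielsen_chain G act_e src tgt fv HE \<rho> \<and>
           (\<forall>x\<in>Vqf. \<exists>r::nat. \<exists>q::nat \<Rightarrow> rat. \<exists>gs::nat \<Rightarrow> 'g.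
               (\<forall>j<r. gs j \<in> carrier G) \<and>
               x = (\<lambda>e. \<Sum>j<r. q j * chain_act G act_e (gs j) \<rho> e))))"

definition l2_rel :: "'e set \<Rightarrow> ('e \<Rightarrow> complex) set" where
  "l2_rel HE = {\<xi>. (\<lambda>e. (cmod (\<xi> e))\<^sup>2) summable_on UNIV \<and> (\<forall>e\<in>HE. \<xi> e = 0)}"

definition l2norm :: "('e \<Rightarrow> complex) \<Rightarrow> real" where
  "l2norm \<xi> = sqrt (\<Sum>\<^sub>\<infinity>e. (cmod (\<xi> e))\<^sup>2)"

text \<open>The bounded extension of A_{f,H} to the L^2 chains (given coordinatewise;
  in the standing setup, each coordinate sum is finite).\<close>
definition A2_fH :: "('e \<Rightarrow> 'v) \<Rightarrow> ('e \<Rightarrow> 'v) \<Rightarrow> ('v \<Rightarrow> 'v) \<Rightarrow> 'e set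
    \<Rightarrow> ('e \<Rightarrow> complex) \<Rightarrow> ('e \<Rightarrow> complex)" where
  "A2_fH src tgt fv HE \<xi> =
     (\<lambda>e'. if e' \<in> HE then 0 else
        (\<Sum>e | path_chain src tgt (fv (src e)) (fv (tgt e)) e' \<noteq> 0.
            \<xi> e * of_int (path_chain src tgt (fv (src e)) (fv (tgt e)) e')))"

definition complex_span_chains :: "('e \<Rightarrow> rat) set \<Rightarrow> ('e \<Rightarrow> complex) set" where
  "complex_span_chains V =
     {(\<lambda>e. \<Sum>x\<in>S. c x * of_real (real_of_rat (x e))) | S c. finite S \<and> S \<subseteq> V}"

definition L2_closure :: "'e set \<Rightarrow> ('e \<Rightarrow> rat) set \<Rightarrow> ('e \<Rightarrow> complex) set" where
  "L2_closure HE V =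
     {\<xi> \<in> l2_rel HE. \<forall>\<epsilon>>0. \<exists>y\<in>complex_span_chains V. l2norm (\<lambda>e. \<xi> e - y e) < \<epsilon>}"

end

theory Submission
  imports Defs
begin

text \<open>The lift of \<open>f\<close> fixes both endpoints of the path defining the Nielsen chain \<open>\<rho>\<close>, so
  \<open>A\<^sup>k (\<Sum> c\<^sub>g g \<rho>) = \<Sum> c\<^sub>g \<Phi>\<^sup>k(g) \<rho>\<close>: the operator merely permutes the coefficients.  It therefore
  suffices to compare the norm of \<open>\<Sum> c\<^sub>g g \<rho>\<close> with the \<open>\<ell>\<^sup>2\<close> norm of \<open>c\<close>.  The upper bound holds since
  every edge lies in boundedly many translates of \<open>\<rho>\<close>.  For non-geometric \<open>\<rho>\<close> the coefficients can be
  read off at the translates of a single edge.  For geometric \<open>\<rho>\<close> the edge shared by \<open>g \<rho>\<close> and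
  \<open>g s \<rho>\<close> has coefficient \<open>\<plusminus>c\<^sub>g \<plusminus> c\<^sub>g\<^sub>s\<close>, so the norm dominates the Dirichlet energies of \<open>\<bar>c\<bar>\<close>
  in two non-commuting directions \<open>s\<close>.  These satisfy a spectral gap: the axes in the tree of two
  non-commuting elements have four distinct ends, so the group is covered by two sets, each of which
  has three disjoint translates; an almost invariant mass would give each of them at most about a
  third of the total.\<close>

section \<open>Reduced walks and half-trees\<close>

definition bar :: "'e \<times> bool \<Rightarrow> 'e \<times> bool" where
  "bar x = (fst x, \<not> snd x)"

lemma bar_bar [simp]: "bar (bar x) = x"
  by (simp add: bar_def)

lemma fst_eq_cases: "fst x = fst y \<Longrightarrow> y = x \<or> y = bar x"
  by (auto simp: bar_def prod_eq_iff)

lemma reduced_walk_successively: "reduced_walk p \<longleftrightarrow> successively (\<lambda>x y. y \<noteq> bar x) p"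
  unfolding reduced_walk_def successively_conv_nth bar_def
  by (auto simp: prod_eq_iff)

lemma reduced_walk_Nil [simp]: "reduced_walk []"
  by (simp add: reduced_walk_successively)

lemma reduced_walk_Cons:
  "reduced_walk (x # p) \<longleftrightarrow> reduced_walk p \<and> (p \<noteq> [] \<longrightarrow> hd p \<noteq> bar x)"
  by (cases p) (auto simp: reduced_walk_successively)

lemma reduced_walk_append:
  "reduced_walk (p @ q) \<longleftrightarrow>
     reduced_walk p \<and> reduced_walk q \<and> (p \<noteq> [] \<longrightarrow> q \<noteq> [] \<longrightarrow> hd q \<noteq> bar (last p))"
  by (auto simp: reduced_walk_successively successively_append_iff)

lemma walk_chain_Nil [simp]: "walk_chain [] e = 0"
  by (simp add: walk_chain_def)

lemma walk_chain_Cons: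
  "walk_chain (x # p) e =
     (if fst x = e then (if snd x then 1 else -1) else 0) + walk_chain p e"
  by (cases x) (simp add: walk_chain_def)

lemma walk_chain_notin: "e \<notin> fst ` set p \<Longrightarrow> walk_chain p e = 0"
  by (induction p) (auto simp: walk_chain_Cons)

section \<open>Reduced walks in a tree and their chains\<close>

locale edge_tree =
  fixes src tgt :: "'e \<Rightarrow> 'v"
  assumes tree: "is_tree src tgt"
begin

definition orig :: "'e \<times> bool \<Rightarrow> 'v" where
  "orig x = (if snd x then src (fst x) else tgt (fst x))"

definition dest :: "'e \<times> bool \<Rightarrow> 'v" where
  "dest x = (if snd x then tgt (fst x) else src (fst x))"

lemma orig_bar [simp]: "orig (bar x) = dest x" and dest_bar [simp]: "dest (bar x) = orig x"
  by (simp_all add: orig_def dest_def bar_def)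

abbreviation wlk where "wlk \<equiv> walk src tgt"

lemma walk_Cons: "wlk u (x # p) v \<longleftrightarrow> orig x = u \<and> wlk (dest x) p v"
  by (cases x) (auto simp: orig_def dest_def)

lemma walk_append: "wlk u (p @ q) v \<longleftrightarrow> (\<exists>w. wlk u p w \<and> wlk w q v)"
  by (induction p arbitrary: u) (auto simp: walk_Cons)

lemma walk_nth:
  assumes "wlk u p v" "p \<noteq> []"
  shows "orig (p ! 0) = u" "dest (last p) = v"
    "Suc i < length p \<Longrightarrow> dest (p ! i) = orig (p ! Suc i)"
proof -
  show "orig (p ! 0) = u" using assms by (cases p) (auto simp: walk_Cons)
  show "dest (last p) = v" using assms by (induction p arbitrary: u) (auto simp: walk_Cons)
  show "dest (p ! i) = orig (p ! Suc i)" if "Suc i < length p"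
    using assms(1) that
  proof (induction p arbitrary: u i)
    case (Cons x p)
    show ?case
    proof (cases i)
      case 0
      with Cons.prems show ?thesis by (cases p) (auto simp: walk_Cons)
    next
      case (Suc j)
      with Cons show ?thesis by (auto simp: walk_Cons)
    qed
  qed simp
qed

lemma ex_path: obtains p where "wlk u p v" "reduced_walk p"
  using tree unfolding is_tree_def by blast

lemma path_unique:
  "\<lbrakk>wlk u p v; reduced_walk p; wlk u q v; reduced_walk q\<rbrakk> \<Longrightarrow> p = q"
  using tree unfolding is_tree_def by blast

text \<open>Backtracking contributes opposite signs, so a walk need not be reduced to compute the
  chain between its endpoints. This makes chains additive under concatenation of arbitrary
  walks.\<close>

lemma path_chain_eq_walk_chain:
  assumes "wlk u p v" shows "path_chain src tgt u v = walk_chain p"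
  using assms
proof (induction p arbitrary: u)
  have eq: "path_chain src tgt u v = walk_chain q" if "wlk u q v" "reduced_walk q" for u q
  proof -
    have "(THE p. wlk u p v \<and> reduced_walk p) = q"
      using that path_unique by blast
    then show ?thesis by (simp add: path_chain_def)
  qed
  {
    case Nil
    then show ?case using eq[of u "[]"] by simp
  next
    case (Cons x p)
    \<comment> \<open>The tail is replaced by its reduced form, with the same chain; prepending
      \<open>x\<close> either keeps it reduced or cancels its first step.\<close>
    obtain q where q: "wlk (dest x) q v" "reduced_walk q"
      by (rule ex_path)
    have pq: "walk_chain p = walk_chain q"
      using Cons eq[OF q] by (simp add: walk_Cons)
    show ?case
    proof (cases "reduced_walk (x # q)")
      case True
      then show ?thesis using Cons.prems q eq[of u "x # q"] pq
        by (simp add: walk_Cons walk_chain_Cons fun_eq_iff)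
    next
      case False
      then obtain q' where q': "q = bar x # q'"
        using q by (cases q) (auto simp: reduced_walk_Cons)
      then have "path_chain src tgt u v = walk_chain q'"
        using q Cons.prems by (intro eq) (auto simp: walk_Cons reduced_walk_Cons)
      also have "\<dots> = walk_chain (x # q)"
        by (auto simp: fun_eq_iff q' walk_chain_Cons bar_def)
      finally show ?thesis using pq by (simp add: walk_chain_Cons fun_eq_iff)
    qed
  }
qed

lemma finite_supp_path_chain: "finite (supp (path_chain src tgt u v))"
proof -
  obtain p where p: "wlk u p v" by (rule ex_path)
  have "supp (path_chain src tgt u v) \<subseteq> fst ` set p"
    using walk_chain_notin by (fastforce simp: supp_def path_chain_eq_walk_chain[OF p])
  then show ?thesis by (rule finite_subset) simp
qed

lemma path_chain_add:
  "path_chain src tgt u w e = path_chain src tgt u v e + path_chain src tgt v w e"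
proof -
  obtain p q where p: "wlk u p v" and q: "wlk v q w" by (metis ex_path)
  then have pq: "wlk u (p @ q) w" by (auto simp: walk_append)
  show ?thesis
    by (simp add: path_chain_eq_walk_chain[OF p] path_chain_eq_walk_chain[OF q]
        path_chain_eq_walk_chain[OF pq] walk_chain_def)
qed

lemma path_chain_refl [simp]: "path_chain src tgt u u e = 0"
  using path_chain_add[of u u e u] by simp

lemma path_chain_flip: "path_chain src tgt v u e = - path_chain src tgt u v e"
  using path_chain_add[of u u e v] by simp

lemma path_chain_edge: "path_chain src tgt (src e) (tgt e) e' = (if e = e' then 1 else 0)"
  using path_chain_eq_walk_chain[of "src e" "[(e, True)]" "tgt e"]
  by (simp add: walk_chain_Cons)

lemma closed_reduced_walk: "wlk u p u \<Longrightarrow> reduced_walk p \<Longrightarrow> p = []"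
  using path_unique[of u p u "[]"] by simp

text \<open>A second crossing in the same direction closes up a nonempty reduced walk. In the
  opposite direction the segment in between is closed, hence empty, so the two crossings would
  backtrack.\<close>

lemma reduced_walk_crosses_once:
  assumes "wlk u (x # q) v" "reduced_walk (x # q)" shows "fst x \<notin> fst ` set q"
proof
  assume "fst x \<in> fst ` set q"
  then obtain y where y: "y \<in> set q" "fst x = fst y" by auto
  then obtain a c where q: "q = a @ y # c" by (meson split_list)
  from assms q have a: "wlk (dest x) a (orig y)" "reduced_walk (x # a)"
    "hd (a @ [y]) \<noteq> bar x"
    by (auto simp: walk_Cons walk_append reduced_walk_Cons reduced_walk_append hd_append
        split: if_splits)
  from fst_eq_cases[OF y(2)] show False
  proof
    assume "y = x"
    then have "wlk (orig x) (x # a) (orig x)" using a by (simp add: walk_Cons)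
    from closed_reduced_walk[OF this a(2)] show False by simp
  next
    assume yx: "y = bar x"
    then have "a = []" using a closed_reduced_walk[of "dest x" a]
      by (auto simp: reduced_walk_Cons)
    then show False using a yx by simp
  qed
qed

text \<open>An edge is crossed at most once. Hence the nonzero coefficients of a Nielsen chain have
  modulus one.\<close>

lemma path_chain_values: "path_chain src tgt u v e \<in> {-1, 0, 1}"
proof -
  obtain p where p: "wlk u p v" "reduced_walk p" by (rule ex_path)
  have "walk_chain p e \<in> {-1, 0, 1}"
    using p
  proof (induction p arbitrary: u)
    case (Cons x p)
    then show ?case
      using reduced_walk_crosses_once[OF Cons.prems]
      by (auto simp: walk_chain_Cons walk_Cons reduced_walk_Cons walk_chain_notin)
  qed simp
  then show ?thesis using path_chain_eq_walk_chain[OF p(1)] by simp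
qed

text \<open>The component containing \<open>dest x\<close> after the edge of \<open>x\<close> is
  cut, expressed through the first step of the reduced walk from \<open>orig x\<close>.\<close>

definition half_tree :: "'e \<times> bool \<Rightarrow> 'v set" where
  "half_tree x = {v. \<exists>p. wlk (orig x) (x # p) v \<and> reduced_walk (x # p)}"

text \<open>The reduced walk from \<open>orig x\<close> to a vertex either starts with
  \<open>x\<close>, or stays reduced when \<open>bar x\<close> is put in front; uniqueness of
  reduced walks excludes both.\<close>

lemma half_tree_bar: "half_tree (bar x) = - half_tree x"
proof -
  have "v \<notin> half_tree x" if v: "v \<in> half_tree (bar x)" for v
  proof
    assume "v \<in> half_tree x"
    then obtain p where p: "wlk (orig x) (x # p) v" "reduced_walk (x # p)"
      by (auto simp: half_tree_def)
    obtain q where q: "wlk (dest x) (bar x # q) v" "reduced_walk (bar x # q)"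
      using v by (auto simp: half_tree_def)
    then have "q = x # p"
      using p by (intro path_unique[of "orig x" q v]) (auto simp: walk_Cons reduced_walk_Cons)
    with q show False by (simp add: reduced_walk_Cons)
  qed
  moreover have "v \<in> half_tree (bar x)" if "v \<notin> half_tree x" for v
  proof -
    obtain q where q: "wlk (orig x) q v" "reduced_walk q" by (rule ex_path)
    then have "reduced_walk (bar x # q)"
      using that by (cases q) (auto simp: half_tree_def reduced_walk_Cons)
    with q show ?thesis by (auto simp: half_tree_def walk_Cons)
  qed
  ultimately show ?thesis by blast
qed

lemma half_tree_mono:
  assumes "dest x = orig y" "y \<noteq> bar x" shows "half_tree y \<subseteq> half_tree x"
proof
  fix v assume "v \<in> half_tree y"
  then obtain p where "wlk (orig y) (y # p) v" "reduced_walk (y # p)"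
    by (auto simp: half_tree_def)
  then have "wlk (orig x) (x # y # p) v" "reduced_walk (x # y # p)"
    using assms by (auto simp: walk_Cons reduced_walk_Cons)
  then show "v \<in> half_tree x" unfolding half_tree_def by blast
qed

section \<open>Rays and their ends\<close>

definition ray :: "(nat \<Rightarrow> 'e \<times> bool) \<Rightarrow> bool" where
  "ray r \<longleftrightarrow> (\<forall>i. dest (r i) = orig (r (Suc i)) \<and> r (Suc i) \<noteq> bar (r i))"

lemma ray_half_tree_mono:
  assumes "ray r" "i \<le> j" shows "half_tree (r j) \<subseteq> half_tree (r i)"
proof -
  have "antimono (\<lambda>i. half_tree (r i))"
    using assms(1) half_tree_mono by (intro decseq_SucI) (auto simp: ray_def)
  then show ?thesis using assms(2) by (auto dest: antimonoD)
qed

text \<open>To reach a vertex beyond the \<open>n\<close>-th step, the reduced walk must follow the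
  ray that far. Uniqueness of reduced walks can then be used to compare two rays.\<close>

lemma ray_half_tree_path:
  assumes "ray r" "v \<in> half_tree (r n)"
  obtains p where "wlk (orig (r 0)) (map r [0..<Suc n] @ p) v" "reduced_walk (map r [0..<Suc n] @ p)"
proof -
  have "\<exists>p. wlk (orig (r 0)) (map r [0..<Suc n] @ p) v \<and> reduced_walk (map r [0..<Suc n] @ p)"
    using assms
  proof (induction n arbitrary: r)
    case 0
    then show ?case by (auto simp: half_tree_def)
  next
    case (Suc n)
    let ?r = "\<lambda>i. r (Suc i)"
    have "ray ?r" using Suc.prems by (simp add: ray_def)
    then obtain p where p: "wlk (orig (r 1)) (map ?r [0..<Suc n] @ p) v"
      "reduced_walk (map ?r [0..<Suc n] @ p)"
      using Suc.IH[of ?r] Suc.prems by auto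
    have eq: "map r [0..<Suc (Suc n)] = r 0 # map ?r [0..<Suc n]"
      by (simp add: upt_conv_Cons map_Suc_upt[symmetric] del: upt_Suc)
    have eq': "hd (map ?r [0..<Suc n] @ p) = r 1"
      by (simp add: upt_conv_Cons del: upt_Suc)
    have "wlk (orig (r 0)) (map r [0..<Suc (Suc n)] @ p) v"
      using p Suc.prems by (auto simp: eq walk_Cons ray_def simp del: upt_Suc)
    moreover have "reduced_walk (map r [0..<Suc (Suc n)] @ p)"
      using p Suc.prems eq' by (auto simp: eq reduced_walk_Cons ray_def simp del: upt_Suc)
    ultimately show ?case by blast
  qed
  with that show thesis by blast
qed

text \<open>Moves the origin of a ray without changing its end. Along the connecting walk, each step
  is either put in front of the ray or cancelled against its first step.\<close>

lemma ray_rebase: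
  assumes "ray s" "wlk u q (orig (s 0))"
  obtains t i j where "ray t" "orig (t 0) = u" "\<And>k. t (i + k) = s (j + k)"
proof -
  have "\<exists>t i j. ray t \<and> orig (t 0) = u \<and> (\<forall>k. t (i + k) = s (j + k))"
    using assms(2)
  proof (induction q arbitrary: u)
    case Nil
    then show ?case using assms(1) by (metis walk.simps(1))
  next
    case (Cons x q)
    then have "\<exists>t i j. ray t \<and> orig (t 0) = dest x \<and> (\<forall>k. t (i + k) = s (j + k))"
      by (simp add: walk_Cons)
    then obtain t i j where t: "ray t" "orig (t 0) = dest x" "\<And>k. t (i + k) = s (j + k)"
      by blast
    show ?case
    proof (cases "t 0 = bar x")
      case True
      have "ray (\<lambda>k. t (Suc k))" using t by (simp add: ray_def)
      moreover have "orig (t 1) = u"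
        using t True Cons.prems by (metis One_nat_def ray_def dest_bar walk_Cons)
      moreover have "t (Suc (i + k)) = s (Suc j + k)" for k
        using t(3)[of "Suc k"] by simp
      ultimately show ?thesis by (intro exI[of _ "\<lambda>k. t (Suc k)"] exI[of _ i] exI[of _ "Suc j"]) simp
    next
      case False
      have "ray (case_nat x t)"
        using t False by (auto simp: ray_def split: nat.split)
      then show ?thesis using t Cons.prems
        by (intro exI[of _ "case_nat x t"] exI[of _ "Suc i"] exI[of _ j]) (auto simp: walk_Cons)
    qed
  qed
  with that show thesis by blast
qed

text \<open>If the half-trees along two rays always meet, the rays have the same end. After rebasing
  to a common origin, a vertex beyond the \<open>n\<close>-th step of both is reached by one reduced
  walk, whose initial segment is that of either ray.\<close>

lemma rays_coincide_or_diverge: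
  assumes r: "ray r" and s: "ray s" and meet: "\<And>i j. half_tree (r i) \<inter> half_tree (s j) \<noteq> {}"
  shows "\<exists>i j. \<forall>k. r (i + k) = s (j + k)"
proof -
  obtain q where "wlk (orig (r 0)) q (orig (s 0))" by (rule ex_path)
  from ray_rebase[OF s this] obtain t i j
    where t: "ray t" "orig (t 0) = orig (r 0)" "\<And>k. t (i + k) = s (j + k)" by metis
  have "r (i + k) = t (i + k)" for k
  proof -
    obtain v where v: "v \<in> half_tree (r (i + k))" "v \<in> half_tree (t (i + k))"
      using meet[of "i + k" "j + k"] t(3) by auto
    obtain p where p: "wlk (orig (r 0)) (map r [0..<Suc (i + k)] @ p) v"
       "reduced_walk (map r [0..<Suc (i + k)] @ p)"
      using ray_half_tree_path[OF r v(1)] .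
    obtain p' where p': "wlk (orig (r 0)) (map t [0..<Suc (i + k)] @ p') v"
       "reduced_walk (map t [0..<Suc (i + k)] @ p')"
      using ray_half_tree_path[OF t(1) v(2)] t(2) by metis
    have "map r [0..<Suc (i + k)] = map t [0..<Suc (i + k)]"
      using path_unique[OF p p'] by (metis append_eq_append_conv length_map)
    then show ?thesis by simp
  qed
  with t(3) show ?thesis by metis
qed

end

section \<open>Free actions on trees\<close>

locale tree_action = edge_tree src tgt
  for src tgt :: "'e \<Rightarrow> 'v" +
  fixes G :: "'g monoid" (structure)
    and act_v :: "'g \<Rightarrow> 'v \<Rightarrow> 'v" and act_e :: "'g \<Rightarrow> 'e \<Rightarrow> 'e"
  assumes deck: "deck_action G act_v act_e src tgt"
begin

sublocale group G
  using deck by (simp add: deck_action_def)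

lemma act_v_one [simp]: "act_v \<one> v = v"
  and act_e_one [simp]: "act_e \<one> e = e"
  using deck unfolding deck_action_def by simp_all

lemma act_v_mult: "\<lbrakk>g \<in> carrier G; h \<in> carrier G\<rbrakk> \<Longrightarrow> act_v (g \<otimes> h) v = act_v g (act_v h v)"
  and act_e_mult: "\<lbrakk>g \<in> carrier G; h \<in> carrier G\<rbrakk> \<Longrightarrow> act_e (g \<otimes> h) e = act_e g (act_e h e)"
  and src_act: "g \<in> carrier G \<Longrightarrow> src (act_e g e) = act_v g (src e)"
  and tgt_act: "g \<in> carrier G \<Longrightarrow> tgt (act_e g e) = act_v g (tgt e)"
  using deck unfolding deck_action_def by simp_all

lemma act_v_free: "\<lbrakk>g \<in> carrier G; act_v g v = v\<rbrakk> \<Longrightarrow> g = \<one>"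
  using deck unfolding deck_action_def by metis

lemma finite_edge_orbits: "\<exists>R. finite R \<and> (\<forall>e. \<exists>g\<in>carrier G. \<exists>d\<in>R. e = act_e g d)"
  using deck unfolding deck_action_def by (elim conjE)

lemma act_e_inv [simp]:
  assumes "g \<in> carrier G"
  shows "act_e (inv g) (act_e g e) = e" "act_e g (act_e (inv g) e) = e"
  using assms by (simp_all flip: act_e_mult)

lemma act_v_inv [simp]:
  assumes "g \<in> carrier G"
  shows "act_v (inv g) (act_v g v) = v" "act_v g (act_v (inv g) v) = v"
  using assms by (simp_all flip: act_v_mult)

lemma act_e_cancel: "g \<in> carrier G \<Longrightarrow> act_e g e = act_e g d \<longleftrightarrow> e = d"
  by (metis act_e_inv(1))

lemma act_e_free:
  assumes "g \<in> carrier G" "h \<in> carrier G" "act_e g e = act_e h e"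
  shows "g = h"
proof -
  have "act_v g (src e) = act_v h (src e)"
    using assms src_act by metis
  then have "act_v (inv h \<otimes> g) (src e) = src e"
    using assms by (simp add: act_v_mult)
  then have "inv h \<otimes> g = \<one>"
    using assms by (intro act_v_free) auto
  then show ?thesis
    using assms by (metis inv_equality inv_inv inv_closed)
qed

definition shift :: "'g \<Rightarrow> 'e \<times> bool \<Rightarrow> 'e \<times> bool" where
  "shift g x = (act_e g (fst x), snd x)"

lemma shift_one [simp]: "shift \<one> x = x"
  by (simp add: shift_def)

lemma shift_mult: "\<lbrakk>g \<in> carrier G; h \<in> carrier G\<rbrakk> \<Longrightarrow> shift (g \<otimes> h) x = shift g (shift h x)"
  by (simp add: shift_def act_e_mult)

lemma shift_cancel: "g \<in> carrier G \<Longrightarrow> shift g x = shift g y \<longleftrightarrow> x = y"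
  by (auto simp: shift_def act_e_cancel prod_eq_iff)

lemma shift_bar: "shift g (bar x) = bar (shift g x)"
  by (simp add: shift_def bar_def)

lemma orig_shift: "g \<in> carrier G \<Longrightarrow> orig (shift g x) = act_v g (orig x)"
  and dest_shift: "g \<in> carrier G \<Longrightarrow> dest (shift g x) = act_v g (dest x)"
  by (simp_all add: shift_def orig_def dest_def src_act tgt_act)

lemma walk_shift:
  "\<lbrakk>g \<in> carrier G; wlk u p v\<rbrakk> \<Longrightarrow> wlk (act_v g u) (map (shift g) p) (act_v g v)"
  by (induction p arbitrary: u) (auto simp: walk_Cons orig_shift dest_shift)

lemma reduced_walk_shift:
  assumes "g \<in> carrier G" shows "reduced_walk (map (shift g) p) \<longleftrightarrow> reduced_walk p"
proof (induction p)
  case (Cons x p)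
  then show ?case
    by (cases p) (auto simp: reduced_walk_Cons shift_cancel[OF assms] simp flip: shift_bar)
qed simp

lemma path_chain_act:
  assumes g: "g \<in> carrier G"
  shows "path_chain src tgt (act_v g u) (act_v g v) e = path_chain src tgt u v (act_e (inv g) e)"
proof -
  obtain p where p: "wlk u p v" by (rule ex_path)
  have "walk_chain (map (shift g) p) e = walk_chain p (act_e (inv g) e)"
    using g by (induction p) (auto simp: walk_chain_Cons shift_def)
  then show ?thesis
    by (simp add: path_chain_eq_walk_chain[OF p] path_chain_eq_walk_chain[OF walk_shift[OF g p]])
qed

lemma half_tree_shift:
  assumes g: "g \<in> carrier G" and v: "v \<in> half_tree x"
  shows "act_v g v \<in> half_tree (shift g x)"
proof -
  obtain p where p: "wlk (orig x) (x # p) v" "reduced_walk (x # p)"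
    using v by (auto simp: half_tree_def)
  from walk_shift[OF g p(1)] reduced_walk_shift[OF g, of "x # p"] p(2) g
  show ?thesis by (auto simp: half_tree_def orig_shift)
qed

text \<open>A vertex of minimal displacement works: if the walk to its image failed to be cyclically
  reduced, moving the vertex along the first step would shorten the walk by two.\<close>

lemma ex_cyclically_reduced_walk:
  assumes g: "g \<in> carrier G" "g \<noteq> \<one>"
  obtains v p where "wlk v p (act_v g v)" "p \<noteq> []" "reduced_walk p" "shift g (hd p) \<noteq> bar (last p)"
proof -
  let ?P = "\<lambda>x. wlk (fst x) (snd x) (act_v g (fst x)) \<and> reduced_walk (snd x)"
  obtain p where "wlk undefined p (act_v g undefined)" "reduced_walk p" by (rule ex_path)
  then have "?P (undefined, p)" by simp
  from ex_has_least_nat[of ?P, OF this, of "\<lambda>x. length (snd x)"]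
  obtain x where x: "?P x" "\<forall>y. ?P y \<longrightarrow> length (snd x) \<le> length (snd y)"
    by (elim exE conjE) (rule that; simp)
  define v p where "v = fst x" and "p = snd x"
  have vp: "wlk v p (act_v g v)" "reduced_walk p"
    using x(1) by (simp_all add: v_def p_def)
  have min: "length p \<le> length q" if "wlk w q (act_v g w)" "reduced_walk q" for w q
    using x(2)[rule_format, of "(w, q)"] that by (simp add: p_def)
  have "p \<noteq> []"
  proof
    assume "p = []"
    with vp have "act_v g v = v" by simp
    with g act_v_free show False by metis
  qed
  moreover have "shift g (hd p) \<noteq> bar (last p)"
  proof
    assume eq: "shift g (hd p) = bar (last p)"
    \<comment> \<open>\<open>shift\<close> preserves the direction bit and \<open>bar\<close> flips
      it, so the first and last steps differ and \<open>p\<close> has at least two steps.\<close>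
    have "snd (hd p) \<noteq> snd (last p)"
      using arg_cong[OF eq, of snd] by (simp add: shift_def bar_def)
    then obtain x p' where "p = x # p'" "p' \<noteq> []"
      using \<open>p \<noteq> []\<close> by (cases p) (auto split: if_splits)
    then obtain r y where p: "p = x # r @ [y]"
      by (cases p' rule: rev_cases) auto
    then have y: "y = bar (shift g x)" using eq by simp
    have "wlk (dest x) r (orig y)" "reduced_walk r"
      using vp by (auto simp: p walk_Cons walk_append reduced_walk_Cons reduced_walk_append)
    then have "wlk (dest x) r (act_v g (dest x))" using g by (simp add: y dest_shift)
    from min[OF this] \<open>reduced_walk r\<close> show False by (simp add: p)
  qed
  ultimately show thesis using that[OF vp(1)] vp(2) by simp
qed

section \<open>Axes of group elements and the covering by wandering sets\<close>

definition axis :: "'g \<Rightarrow> nat \<Rightarrow> (int \<Rightarrow> 'e \<times> bool) \<Rightarrow> bool" where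
  "axis g l \<alpha> \<longleftrightarrow> 0 < l \<and>
     (\<forall>i. dest (\<alpha> i) = orig (\<alpha> (i + 1)) \<and> \<alpha> (i + 1) \<noteq> bar (\<alpha> i) \<and> shift g (\<alpha> i) = \<alpha> (i + int l))"

text \<open>The translates of a cyclically reduced walk by the powers of \<open>g\<close> are
  concatenated; cyclic reducedness is what is needed at the joints.\<close>

lemma ex_axis:
  assumes g: "g \<in> carrier G" "g \<noteq> \<one>"
  obtains l \<alpha> where "axis g l \<alpha>"
proof -
  obtain v p where p: "wlk v p (act_v g v)" "p \<noteq> []" "reduced_walk p"
    and cyc: "shift g (hd p) \<noteq> bar (last p)"
    by (rule ex_cyclically_reduced_walk[OF g])
  define l where "l = length p"
  have l: "0 < l" using p by (simp add: l_def)
  define \<alpha> where "\<alpha> i = shift (g [^] (i div int l)) (p ! nat (i mod int l))" for i :: int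
  have pow: "g [^] (z::int) \<in> carrier G" for z using g by simp
  have pow1: "g [^] (z + 1::int) = g [^] z \<otimes> g" for z
    using g by (simp add: int_pow_mult)
  have pow1': "g [^] (z + 1::int) = g \<otimes> g [^] z" for z
    using g int_pow_mult[of g 1 z] by (simp add: add.commute)
  have step: "dest (\<alpha> i) = orig (\<alpha> (i + 1)) \<and> \<alpha> (i + 1) \<noteq> bar (\<alpha> i)" for i
  \<comment> \<open>The first case is the joint, where position \<open>i\<close> ends one translate
    and \<open>i + 1\<close> begins the next; in the second case both lie in the same
    translate.\<close>
  proof (cases "i mod int l = int l - 1")
    case True
    have dm: "(i + 1) mod int l = 0" "(i + 1) div int l = i div int l + 1"
    proof -
      have i: "i + 1 = int l * (i div int l + 1)"
        using True div_mult_mod_eq[of i "int l"] by (simp add: distrib_left mult.commute)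
      show "(i + 1) mod int l = 0" by (subst i) simp
      show "(i + 1) div int l = i div int l + 1" by (subst i) (use l in simp)
    qed
    have nl: "nat (int l - 1) = length p - 1" using l by (simp add: l_def nat_diff_distrib)
    have 1: "\<alpha> i = shift (g [^] (i div int l)) (last p)"
      using p by (simp add: \<alpha>_def True last_conv_nth nl)
    have 2: "\<alpha> (i + 1) = shift (g [^] (i div int l)) (shift g (hd p))"
      using p g by (simp add: \<alpha>_def dm pow1 shift_mult hd_conv_nth)
    have "dest (last p) = orig (shift g (hd p))"
      using walk_nth(1,2)[OF p(1,2)] p g by (simp add: orig_shift hd_conv_nth)
    then show ?thesis
      using cyc pow g unfolding 1 2 by (simp add: orig_shift dest_shift shift_cancel flip: shift_bar)
  next
    case False
    define k where "k = nat (i mod int l)"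
    have im: "i mod int l = int k" using l by (simp add: k_def)
    have "i mod int l < int l" using l by simp
    with False im have k: "Suc k < l" by simp
    have i: "i = int k + int l * (i div int l)" using im mult_div_mod_eq[of "int l" i] by linarith
    have dm: "(i + 1) mod int l = int (Suc k)" "(i + 1) div int l = i div int l"
    proof -
      have i1: "i + 1 = int (Suc k) + int l * (i div int l)" using i by simp
      show "(i + 1) mod int l = int (Suc k)"
        using k by (subst i1) (simp only: mod_mult_self2 mod_pos_pos_trivial)
      show "(i + 1) div int l = i div int l"
        by (subst i1, subst div_mult_self2) (use k l in \<open>auto simp: div_pos_pos_trivial\<close>)
    qed
    have 1: "\<alpha> i = shift (g [^] (i div int l)) (p ! k)"
      by (simp add: \<alpha>_def im)
    have 2: "\<alpha> (i + 1) = shift (g [^] (i div int l)) (p ! Suc k)"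
      by (simp only: \<alpha>_def dm nat_int)
    have "p ! Suc k \<noteq> bar (p ! k)"
      using p(3) k by (simp add: reduced_walk_successively successively_conv_nth l_def)
    then show ?thesis
      using walk_nth(3)[OF p(1,2)] k pow unfolding 1 2
      by (simp add: l_def orig_shift dest_shift shift_cancel flip: shift_bar)
  qed
  have "shift g (\<alpha> i) = \<alpha> (i + int l)" for i
    using l g pow by (simp add: \<alpha>_def pow1' shift_mult)
  with step l have "axis g l \<alpha>" by (simp add: axis_def)
  with that show thesis .
qed

text \<open>On a common tail both elements act as index shifts, which commute. Then
  \<open>a \<otimes> b\<close> and \<open>b \<otimes> a\<close> would agree on an edge and be equal,
  as the action is free.\<close>

lemma noncommuting_rays_diverge:
  assumes ab: "a \<in> carrier G" "b \<in> carrier G" "a \<otimes> b \<noteq> b \<otimes> a"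
    and r: "ray r" "\<And>i. shift a (r i) = r (i + l)"
    and s: "ray s" "\<And>i. shift b (s i) = s (i + m)"
  shows "\<exists>N. \<forall>i\<ge>N. \<forall>j\<ge>N. half_tree (r i) \<inter> half_tree (s j) = {}"
proof -
  have "\<exists>i j. half_tree (r i) \<inter> half_tree (s j) = {}"
  proof (rule ccontr)
    assume "\<not> ?thesis"
    then have "half_tree (r i) \<inter> half_tree (s j) \<noteq> {}" for i j by blast
    from rays_coincide_or_diverge[OF r(1) s(1) this]
    obtain i j where "\<forall>k. r (i + k) = s (j + k)" by (elim exE) (rule that)
    then have eq: "r (i + k) = s (j + k)" for k by (rule spec)
    have "shift (a \<otimes> b) (r i) = shift a (r (i + m))"
      using ab s(2)[of j] eq[of 0] eq[of m] by (simp add: shift_mult)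
    also have "\<dots> = r (i + m + l)"
      by (rule r(2))
    also have "\<dots> = r (i + (l + m))"
      by (simp add: ac_simps)
    also have "\<dots> = shift b (s (j + l))"
      using s(2)[of "j + l"] eq[of "l + m"] by (simp add: add.assoc)
    also have "\<dots> = shift b (r (i + l))"
      by (simp only: eq)
    also have "\<dots> = shift (b \<otimes> a) (r i)"
      using ab r(2)[of i] by (simp add: shift_mult)
    finally have "act_e (a \<otimes> b) (fst (r i)) = act_e (b \<otimes> a) (fst (r i))"
      by (simp add: shift_def)
    from act_e_free[OF _ _ this] ab show False by simp
  qed
  then obtain i j where ij: "half_tree (r i) \<inter> half_tree (s j) = {}" by blast
  \<comment> \<open>One disjoint pair suffices, because half-trees along a ray are nested.\<close>
  have "half_tree (r i') \<inter> half_tree (s j') = {}" if "max i j \<le> i'" "max i j \<le> j'" for i' j'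
  proof -
    have "half_tree (r i') \<subseteq> half_tree (r i)" "half_tree (s j') \<subseteq> half_tree (s j)"
      using that by (simp_all add: ray_half_tree_mono r(1) s(1))
    with ij show ?thesis by blast
  qed
  then show ?thesis by (intro exI[of _ "max i j"]) simp
qed

lemma axis_ray:
  assumes "axis g l \<alpha>"
  shows "ray (\<lambda>i. \<alpha> (int i))"
  using assms by (simp add: axis_def ray_def add.commute[of 1])

text \<open>The axis read backwards. It is translated forward by \<open>inv g\<close>, so the
  repelling end of \<open>g\<close> can be treated as the attracting end of its inverse.\<close>

lemma axis_ray_inv:
  assumes "axis g l \<alpha>"
  shows "ray (\<lambda>i. bar (\<alpha> (- int i)))"
  unfolding ray_def
proof
  fix i
  have "dest (\<alpha> (- int (Suc i))) = orig (\<alpha> (- int i))"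
    "\<alpha> (- int i) \<noteq> bar (\<alpha> (- int (Suc i)))"
    using assms[unfolded axis_def, THEN conjunct2, rule_format, of "- int (Suc i)"] by simp_all
  then show "dest (bar (\<alpha> (- int i))) = orig (bar (\<alpha> (- int (Suc i)))) \<and>
      bar (\<alpha> (- int (Suc i))) \<noteq> bar (bar (\<alpha> (- int i)))"
    by auto
qed

lemma axis_shift_inv:
  assumes "axis g l \<alpha>" "g \<in> carrier G"
  shows "shift (inv g) (bar (\<alpha> (- int i))) = bar (\<alpha> (- int (i + l)))"
proof -
  have "shift g (\<alpha> (- int (i + l))) = \<alpha> (- int i)"
    using assms by (simp add: axis_def)
  then have "shift (inv g) (\<alpha> (- int i)) = shift (inv g \<otimes> g) (\<alpha> (- int (i + l)))"
    using assms by (simp only: shift_mult inv_closed)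
  then show ?thesis using assms by (simp add: shift_bar)
qed

lemma axis_half_tree_pow:
  fixes n :: nat
  assumes "axis g l \<alpha>" "g \<in> carrier G" "v \<in> half_tree (\<alpha> i)"
  shows "act_v (g [^] n) v \<in> half_tree (\<alpha> (i + int (n * l)))"
proof (induction n)
  case (Suc n)
  have "act_v (g [^] Suc n) v = act_v g (act_v (g [^] n) v)"
    by (simp only: nat_pow_Suc2[OF assms(2)] act_v_mult[OF assms(2) nat_pow_closed[OF assms(2)]])
  moreover have "shift g (\<alpha> (i + int (n * l))) = \<alpha> (i + int (Suc n * l))"
    using assms(1) unfolding axis_def by (simp add: algebra_simps)
  ultimately show ?case using half_tree_shift[OF assms(2) Suc] by simp
qed (use assms in simp)

lemma inv_noncommuting:
  assumes "a \<in> carrier G" "b \<in> carrier G" "a \<otimes> b \<noteq> b \<otimes> a"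
  shows "inv a \<otimes> b \<noteq> b \<otimes> inv a"
proof
  assume eq: "inv a \<otimes> b = b \<otimes> inv a"
  have "b \<otimes> a = a \<otimes> (inv a \<otimes> b) \<otimes> a"
    using assms by (simp flip: m_assoc)
  also have "\<dots> = a \<otimes> b"
    using assms by (simp add: eq m_assoc)
  finally show False using assms by simp
qed

text \<open>The orbit map pulls \<open>X\<close> and \<open>Y\<close> back from the sets of points lying between two half-trees
  far out on either side of the axis of \<open>a\<close>, respectively of \<open>b\<close>.\<close>

lemma noncommuting_covering:
  assumes ab: "a \<in> carrier G" "b \<in> carrier G" "a \<otimes> b \<noteq> b \<otimes> a"
  shows "\<exists>X Y (n::nat). X \<union> Y = carrier G \<and>
    (\<forall>g\<in>X. g \<otimes> a [^] n \<notin> X \<and> g \<otimes> a [^] n \<otimes> a [^] n \<notin> X) \<and>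
    (\<forall>g\<in>Y. g \<otimes> b [^] n \<notin> Y \<and> g \<otimes> b [^] n \<otimes> b [^] n \<notin> Y)"
proof -
  have "a \<noteq> \<one>" "b \<noteq> \<one>" using ab by auto
  then obtain l \<alpha> m \<beta> where A: "axis a l \<alpha>" and B: "axis b m \<beta>"
    using ex_axis ab by metis
  have ab': "inv a \<otimes> b \<noteq> b \<otimes> inv a" "a \<otimes> inv b \<noteq> inv b \<otimes> a"
    "inv a \<otimes> inv b \<noteq> inv b \<otimes> inv a"
    using inv_noncommuting[OF ab] inv_noncommuting[of b a] inv_noncommuting[of a "inv b"] ab
    by auto
  note rays = axis_ray[OF A] axis_ray[OF B] axis_ray_inv[OF A] axis_ray_inv[OF B]
  have s: "shift a (\<alpha> (int i)) = \<alpha> (int (i + l))" "shift b (\<beta> (int i)) = \<beta> (int (i + m))" for i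
    using A B by (auto simp: axis_def)
  note s' = axis_shift_inv[OF A ab(1)] axis_shift_inv[OF B ab(2)]
  \<comment> \<open>Each of the two ends of one axis is separated from each of the two ends of the
    other, which takes four bounds.\<close>
  obtain N1 where N1: "\<And>i j. N1 \<le> i \<Longrightarrow> N1 \<le> j \<Longrightarrow>
      half_tree (\<alpha> (int i)) \<inter> half_tree (\<beta> (int j)) = {}"
    using noncommuting_rays_diverge[OF ab rays(1) s(1) rays(2) s(2)] by blast
  obtain N2 where N2: "\<And>i j. N2 \<le> i \<Longrightarrow> N2 \<le> j \<Longrightarrow>
      half_tree (bar (\<alpha> (- int i))) \<inter> half_tree (\<beta> (int j)) = {}"
    using noncommuting_rays_diverge[OF inv_closed[OF ab(1)] ab(2) ab'(1) rays(3) s'(1) rays(2) s(2)]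
    by blast
  obtain N3 where N3: "\<And>i j. N3 \<le> i \<Longrightarrow> N3 \<le> j \<Longrightarrow>
      half_tree (\<alpha> (int i)) \<inter> half_tree (bar (\<beta> (- int j))) = {}"
    using noncommuting_rays_diverge[OF ab(1) inv_closed[OF ab(2)] ab'(2) rays(1) s(1) rays(4) s'(2)]
    by blast
  obtain N4 where N4: "\<And>i j. N4 \<le> i \<Longrightarrow> N4 \<le> j \<Longrightarrow>
      half_tree (bar (\<alpha> (- int i))) \<inter> half_tree (bar (\<beta> (- int j))) = {}"
    using noncommuting_rays_diverge[OF inv_closed[OF ab(1)] inv_closed[OF ab(2)] ab'(3)
        rays(3) s'(1) rays(4) s'(2)] by blast
  \<comment> \<open>A single bound for all four pairs; scaling it by the translation lengths, which
    are at least one, only increases it.\<close>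
  define M where "M = N1 + N2 + N3 + N4"
  have lm: "0 < l" "0 < m" using A B by (auto simp: axis_def)
  have "Ni \<le> M" if "Ni \<in> {N1, N2, N3, N4}" for Ni
    using that by (auto simp: M_def)
  moreover have "M \<le> M * l" "M \<le> M * m" using lm by simp_all
  ultimately have M: "Ni \<le> M * l" "Ni \<le> M * m" if "Ni \<in> {N1, N2, N3, N4}" for Ni
    using that le_trans by blast+
  \<comment> \<open>The middle part left by removing an outer half-tree at each end of the axis. A
    vertex outside both middle parts would lie in outer half-trees of both axes, which are
    disjoint.\<close>
  define F where "F k \<gamma> = half_tree (\<gamma> (- int (M * k))) - half_tree (\<gamma> (int (M * k)))"
    for k and \<gamma> :: "int \<Rightarrow> 'e \<times> bool"
  have cover: "v \<in> F l \<alpha> \<or> v \<in> F m \<beta>" for v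
    using N1[of "M * l" "M * m"] N2[of "M * l" "M * m"] N3[of "M * l" "M * m"] N4[of "M * l" "M * m"] M
    unfolding F_def by (auto simp: half_tree_bar simp del: of_nat_mult)
  \<comment> \<open>The power \<open>2 * M\<close> translates by \<open>2 * M * k\<close>, exactly
    the width of the middle part, so its points move past the far edge and remain there when it is
    applied again.\<close>
  have move: "act_v (g [^] (2 * M)) v \<notin> F k \<gamma>"
    "act_v (g [^] (2 * M)) (act_v (g [^] (2 * M)) v) \<notin> F k \<gamma>"
    if \<gamma>: "axis g k \<gamma>" "g \<in> carrier G" and v: "v \<in> F k \<gamma>" for g k \<gamma> v
  proof -
    let ?g = "g [^] (2 * M)"
    have 1: "act_v ?g v \<in> half_tree (\<gamma> (int (M * k)))"
      using axis_half_tree_pow[OF \<gamma>, of v "- int (M * k)" "2 * M"] v by (simp add: F_def algebra_simps)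
    then have "act_v ?g (act_v ?g v) \<in> half_tree (\<gamma> (int (M * k + 2 * M * k)))"
      using axis_half_tree_pow[OF \<gamma> 1, of "2 * M"] by (simp only: of_nat_add)
    then have "act_v ?g (act_v ?g v) \<in> half_tree (\<gamma> (int (M * k)))"
      using ray_half_tree_mono[OF axis_ray[OF \<gamma>(1)], of "M * k" "M * k + 2 * M * k"] by auto
    with 1 show "act_v ?g v \<notin> F k \<gamma>" "act_v ?g (act_v ?g v) \<notin> F k \<gamma>"
      by (auto simp: F_def)
  qed
  define v0 :: 'v where "v0 = undefined"
  \<comment> \<open>Taking the inverse turns the left action on vertices into right multiplication
    in the group, the side on which the energies below are taken.\<close>
  define Z where "Z k \<gamma> = {g \<in> carrier G. act_v (inv g) v0 \<in> F k \<gamma>}" for k and \<gamma> :: "int \<Rightarrow> 'e \<times> bool"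
  have Z: "h \<otimes> g [^] (2 * M) \<notin> Z k \<gamma> \<and> h \<otimes> g [^] (2 * M) \<otimes> g [^] (2 * M) \<notin> Z k \<gamma>"
    if \<gamma>: "axis g k \<gamma>" "g \<in> carrier G" and h: "h \<in> Z k \<gamma>" for g k \<gamma> h
  proof -
    let ?g = "g [^] (2 * M)"
    have c: "?g \<in> carrier G" "h \<in> carrier G" using \<gamma> h by (auto simp: Z_def)
    have F: "act_v (inv h) v0 \<in> F k \<gamma>" using h by (simp add: Z_def)
    have "act_v ?g (act_v (inv (h \<otimes> ?g)) v0) = act_v (inv h) v0"
      "act_v ?g (act_v ?g (act_v (inv (h \<otimes> ?g \<otimes> ?g)) v0)) = act_v (inv h) v0"
      using c by (simp_all add: inv_mult_group act_v_mult)
    then show ?thesis using move[OF \<gamma>] F unfolding Z_def by force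
  qed
  show ?thesis
  proof (intro exI conjI)
    show "Z l \<alpha> \<union> Z m \<beta> = carrier G" using cover by (auto simp: Z_def)
  qed (use Z A B ab in blast)+
qed

end

section \<open>Square-summable chains\<close>

definition sq_summable :: "('e \<Rightarrow> complex) \<Rightarrow> bool" where
  "sq_summable x \<longleftrightarrow> (\<lambda>e. (cmod (x e))\<^sup>2) summable_on UNIV"

lemma l2norm_nonneg [simp]: "0 \<le> l2norm x"
  by (simp add: l2norm_def infsum_nonneg)

lemma l2norm_zero [simp]: "l2norm (\<lambda>_. 0) = 0"
  by (simp add: l2norm_def)

lemma l2norm_minus_commute: "l2norm (\<lambda>e. x e - y e) = l2norm (\<lambda>e. y e - x e)"
  by (simp add: l2norm_def norm_minus_commute)

text \<open>Reduces norm estimates to finite sets of edges, where Minkowski's inequality for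
  \<open>L2_set\<close> is available.\<close>

lemma sq_summable_bound:
  assumes B: "0 \<le> B" "\<And>E. finite E \<Longrightarrow> L2_set (\<lambda>e. cmod (x e)) E \<le> B"
  shows "sq_summable x" "l2norm x \<le> B"
proof -
  have fin: "(\<Sum>e\<in>E. (cmod (x e))\<^sup>2) \<le> B\<^sup>2" if "finite E" for E
    using B that by (simp add: L2_set_def real_sqrt_le_iff' real_le_lsqrt sqrt_le_D)
  then have "bdd_above (sum (\<lambda>e. (cmod (x e))\<^sup>2) ` {F. F \<subseteq> UNIV \<and> finite F})"
    by (auto simp: bdd_above_def)
  then show s: "sq_summable x"
    unfolding sq_summable_def by (intro nonneg_bdd_above_summable_on) auto
  have "(\<Sum>\<^sub>\<infinity>e. (cmod (x e))\<^sup>2) \<le> B\<^sup>2"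
    using s fin unfolding sq_summable_def by (intro infsum_le_finite_sums) auto
  then show "l2norm x \<le> B"
    using B(1) by (simp add: l2norm_def real_le_lsqrt)
qed

lemma L2_set_le_l2norm:
  assumes "sq_summable x" "finite E"
  shows "L2_set (\<lambda>e. cmod (x e)) E \<le> l2norm x"
  unfolding L2_set_def l2norm_def
  using assms by (auto simp: sq_summable_def intro!: finite_sum_le_infsum)

lemma l2norm_triangle:
  assumes x: "sq_summable x" and y: "sq_summable y"
  shows "sq_summable (\<lambda>e. x e + y e)" "l2norm (\<lambda>e. x e + y e) \<le> l2norm x + l2norm y"
proof -
  have "L2_set (\<lambda>e. cmod (x e + y e)) E \<le> l2norm x + l2norm y" if "finite E" for E
  proof -
    have "L2_set (\<lambda>e. cmod (x e + y e)) E \<le> L2_set (\<lambda>e. cmod (x e) + cmod (y e)) E"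
      by (intro L2_set_mono norm_triangle_ineq) auto
    also have "\<dots> \<le> L2_set (\<lambda>e. cmod (x e)) E + L2_set (\<lambda>e. cmod (y e)) E"
      by (rule L2_set_triangle_ineq)
    also have "\<dots> \<le> l2norm x + l2norm y"
      by (intro add_mono L2_set_le_l2norm x y that)
    finally show ?thesis .
  qed
  from sq_summable_bound[of "l2norm x + l2norm y", OF _ this]
  show "sq_summable (\<lambda>e. x e + y e)" "l2norm (\<lambda>e. x e + y e) \<le> l2norm x + l2norm y"
    by auto
qed

lemma sq_summable_uminus: "sq_summable x \<Longrightarrow> sq_summable (\<lambda>e. - x e)"
  by (simp add: sq_summable_def)

lemma l2norm_triangle_diff:
  assumes x: "sq_summable x" and y: "sq_summable y"
  shows "sq_summable (\<lambda>e. x e - y e)" "l2norm (\<lambda>e. x e - y e) \<le> l2norm x + l2norm y"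
    "l2norm x \<le> l2norm y + l2norm (\<lambda>e. x e - y e)"
proof -
  have [simp]: "l2norm (\<lambda>e. - y e) = l2norm y" by (simp add: l2norm_def)
  show d: "sq_summable (\<lambda>e. x e - y e)" "l2norm (\<lambda>e. x e - y e) \<le> l2norm x + l2norm y"
    using l2norm_triangle[OF x sq_summable_uminus[OF y]] by simp_all
  show "l2norm x \<le> l2norm y + l2norm (\<lambda>e. x e - y e)"
    using l2norm_triangle[OF y d(1)] by simp
qed

lemma cmod_le_l2norm: "sq_summable x \<Longrightarrow> cmod (x e) \<le> l2norm x"
  using L2_set_le_l2norm[of x "{e}"] by simp

text \<open>The bounds pass to the closure by pointwise continuity and Fatou's lemma.\<close>

lemma norm_equivalence_closure:
  fixes A :: "('e \<Rightarrow> complex) \<Rightarrow> ('e \<Rightarrow> complex)"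
  assumes diff: "\<And>x y. A (\<lambda>e. x e - y e) = (\<lambda>e. A x e - A y e)"
    and cont: "\<And>x z e. (\<And>e. (\<lambda>n. x n e) \<longlonglongrightarrow> z e) \<Longrightarrow> (\<lambda>n. A (x n) e) \<longlonglongrightarrow> A z e"
    and W_diff: "\<And>x y. x \<in> W \<Longrightarrow> y \<in> W \<Longrightarrow> (\<lambda>e. x e - y e) \<in> W"
    and W: "\<And>y. y \<in> W \<Longrightarrow> sq_summable y" "\<And>y. y \<in> W \<Longrightarrow> sq_summable (A y)"
      "\<And>y. y \<in> W \<Longrightarrow> l2norm y \<le> C * l2norm (A y)" "\<And>y. y \<in> W \<Longrightarrow> l2norm (A y) \<le> C * l2norm y"
    and C: "0 < C"
    and \<xi>: "sq_summable \<xi>" "\<And>\<epsilon>. \<epsilon> > 0 \<Longrightarrow> \<exists>y\<in>W. l2norm (\<lambda>e. \<xi> e - y e) < \<epsilon>"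
  shows "l2norm \<xi> \<le> C * l2norm (A \<xi>)" "l2norm (A \<xi>) \<le> C * l2norm \<xi>"
proof -
  have "\<forall>n. \<exists>y\<in>W. l2norm (\<lambda>e. \<xi> e - y e) < 1 / real (Suc n)"
    using \<xi>(2) by simp
  then obtain y where y: "\<And>n. y n \<in> W" "\<And>n. l2norm (\<lambda>e. \<xi> e - y n e) < 1 / real (Suc n)"
    by metis
  have lim0: "(\<lambda>n. c / real (Suc n)) \<longlonglongrightarrow> 0" for c :: real
    using tendsto_mult_right_zero[OF LIMSEQ_Suc[OF lim_1_over_n], of c] by simp
  have "(\<lambda>n. y n e) \<longlonglongrightarrow> \<xi> e" for e
  proof (rule LIM_zero_cancel, rule Lim_null_comparison[OF _ lim0[of 1]])
    have "cmod (\<xi> e - y n e) \<le> 1 / real (Suc n)" for n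
      using cmod_le_l2norm[OF l2norm_triangle_diff(1)[OF \<xi>(1) W(1)[OF y(1)]], of e n] y(2)[of n]
      by linarith
    then show "\<forall>\<^sub>F n in sequentially. cmod (y n e - \<xi> e) \<le> 1 / real (Suc n)"
      by (simp add: norm_minus_commute)
  qed
  then have lim: "(\<lambda>n. A (y n) e) \<longlonglongrightarrow> A \<xi> e" for e
    by (rule cont)
  \<comment> \<open>The differences \<open>y m - y n\<close> lie in \<open>W\<close>, so the upper
    bound applies to them. On a finite set of edges the limit in \<open>m\<close> may be taken, and
    the resulting bound does not depend on the set.\<close>
  have fatou: "sq_summable (\<lambda>e. A \<xi> e - A (y n) e) \<and>
      l2norm (\<lambda>e. A \<xi> e - A (y n) e) \<le> C / real (Suc n)" for n
  proof -
    have "L2_set (\<lambda>e. cmod (A \<xi> e - A (y n) e)) E \<le> C / real (Suc n)" if "finite E" for E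
    proof (rule tendsto_le[OF sequentially_bot])
      show "(\<lambda>m. L2_set (\<lambda>e. cmod (A (y m) e - A (y n) e)) E) \<longlonglongrightarrow>
          L2_set (\<lambda>e. cmod (A \<xi> e - A (y n) e)) E"
        unfolding L2_set_def by (intro tendsto_intros lim)
      show "(\<lambda>m. C / real (Suc n) + C / real (Suc m)) \<longlonglongrightarrow> C / real (Suc n)"
        using tendsto_add[OF tendsto_const lim0[of C], of "C / real (Suc n)"] by simp
      have "L2_set (\<lambda>e. cmod (A (y m) e - A (y n) e)) E \<le> C / real (Suc n) + C / real (Suc m)" for m
      proof -
        let ?d = "\<lambda>e. y m e - y n e"
        have dW: "?d \<in> W" using y W_diff by blast
        have "l2norm ?d = l2norm (\<lambda>e. (\<xi> e - y n e) - (\<xi> e - y m e))" by simp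
        also have "\<dots> \<le> l2norm (\<lambda>e. \<xi> e - y n e) + l2norm (\<lambda>e. \<xi> e - y m e)"
          by (intro l2norm_triangle_diff \<xi> W y)
        also have "\<dots> \<le> 1 / real (Suc n) + 1 / real (Suc m)"
          using y(2)[of n] y(2)[of m] by simp
        finally have "C * l2norm ?d \<le> C * (1 / real (Suc n) + 1 / real (Suc m))"
          using C by simp
        moreover have "L2_set (\<lambda>e. cmod (A (y m) e - A (y n) e)) E \<le> l2norm (A ?d)"
          using L2_set_le_l2norm[OF W(2)[OF dW] that] by (simp add: diff)
        ultimately show ?thesis
          using W(4)[OF dW] by (simp add: distrib_left)
      qed
      then show "\<forall>\<^sub>F m in sequentially. L2_set (\<lambda>e. cmod (A (y m) e - A (y n) e)) E
          \<le> C / real (Suc n) + C / real (Suc m)" by simp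
    qed
    then show ?thesis
      using sq_summable_bound[of "C / real (Suc n)" "\<lambda>e. A \<xi> e - A (y n) e"] C by simp
  qed
  have A\<xi>: "sq_summable (A \<xi>)"
    using l2norm_triangle(1)[OF conjunct1[OF fatou] W(2)[OF y(1)], of 0 0] by simp
  have "l2norm (A \<xi>) \<le> C * l2norm \<xi> + 2 * C / real (Suc n)" for n
  proof -
    have "l2norm (A \<xi>) \<le> l2norm (A (y n)) + C / real (Suc n)"
      using l2norm_triangle_diff(3)[OF A\<xi> W(2)[OF y(1)], of n] fatou[of n] by linarith
    also have "l2norm (A (y n)) \<le> C * l2norm (y n)" using W y by simp
    also have "l2norm (y n) \<le> l2norm \<xi> + 1 / real (Suc n)"
      using l2norm_triangle_diff(3)[OF W(1)[OF y(1)] \<xi>(1), of n] y(2)[of n]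
        l2norm_minus_commute[of \<xi> "y n"] by linarith
    finally show ?thesis using C by (simp add: distrib_left)
  qed
  moreover have "(\<lambda>n. C * l2norm \<xi> + 2 * C / real (Suc n)) \<longlonglongrightarrow> C * l2norm \<xi>"
    using tendsto_add[OF tendsto_const lim0[of "2 * C"], of "C * l2norm \<xi>"] by simp
  ultimately show "l2norm (A \<xi>) \<le> C * l2norm \<xi>"
    by (intro LIMSEQ_le_const) auto
  \<comment> \<open>Approximating \<open>\<xi>\<close> costs \<open>1 / real (Suc n)\<close>;
    approximating \<open>A \<xi>\<close> costs \<open>C / real (Suc n)\<close>, multiplied by
    \<open>C\<close>.\<close>
  have "l2norm \<xi> \<le> C * l2norm (A \<xi>) + (C\<^sup>2 + 1) / real (Suc n)" for n
  proof -
    have "l2norm \<xi> \<le> l2norm (y n) + 1 / real (Suc n)"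
      using l2norm_triangle_diff(3)[OF \<xi>(1) W(1)[OF y(1)], of n] y(2)[of n] by linarith
    also have "l2norm (y n) \<le> C * l2norm (A (y n))" using W y by simp
    also have "l2norm (A (y n)) \<le> l2norm (A \<xi>) + C / real (Suc n)"
      using l2norm_triangle_diff(3)[OF W(2)[OF y(1)] A\<xi>, of n] fatou[of n]
        l2norm_minus_commute[of "A \<xi>" "A (y n)"] by linarith
    finally show ?thesis using C by (simp add: distrib_left power2_eq_square add_divide_distrib)
  qed
  moreover have "(\<lambda>n. C * l2norm (A \<xi>) + (C\<^sup>2 + 1) / real (Suc n)) \<longlonglongrightarrow> C * l2norm (A \<xi>)"
    using tendsto_add[OF tendsto_const lim0[of "C\<^sup>2 + 1"], of "C * l2norm (A \<xi>)"] by simp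
  ultimately show "l2norm \<xi> \<le> C * l2norm (A \<xi>)"
    by (intro LIMSEQ_le_const) auto
qed

section \<open>Spectral gap\<close>

lemma power2_diff_le: "(x - z)\<^sup>2 \<le> 2 * (x - y)\<^sup>2 + 2 * (y - z)\<^sup>2" for x y z :: real
  using zero_le_power2[of "(x - y) - (y - z)"] by (simp add: power2_eq_square algebra_simps)

text \<open>The factor 5/4 lies below 3/2, so two sets, each with at most 5/12 of the mass up to
  energy, cannot carry all of it.\<close>

lemma power2_le_shifted: "x\<^sup>2 \<le> 5 / 4 * y\<^sup>2 + 5 * (x - y)\<^sup>2" for x y :: real
  using zero_le_power2[of "4 * x - 5 * y"] by (simp add: power2_eq_square algebra_simps)

context group
begin

text \<open>The squared distance in \<open>\<ell>\<^sup>2\<close> between \<open>\<phi>\<close> and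
  its right translate by \<open>w\<close>.\<close>

definition energy :: "('a \<Rightarrow> real) \<Rightarrow> 'a \<Rightarrow> real" where
  "energy \<phi> w = (\<Sum>\<^sub>\<infinity>g\<in>carrier G. (\<phi> g - \<phi> (g \<otimes> w))\<^sup>2)"

lemma right_mult_bij: "w \<in> carrier G \<Longrightarrow> bij_betw (\<lambda>g. g \<otimes> w) (carrier G) (carrier G)"
  by (rule bij_betw_byWitness[where f' = "\<lambda>g. g \<otimes> inv w"]) (auto simp: m_assoc)

context
  fixes \<phi> :: "'a \<Rightarrow> real"
  assumes \<phi>: "(\<lambda>g. (\<phi> g)\<^sup>2) summable_on carrier G"
begin

lemma translate_summable:
  assumes "w \<in> carrier G" shows "(\<lambda>g. (\<phi> (g \<otimes> w))\<^sup>2) summable_on carrier G"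
  using summable_on_reindex_bij_betw[OF right_mult_bij[OF assms], of "\<lambda>g. (\<phi> g)\<^sup>2"] \<phi> by simp

lemma energy_summable:
  assumes "v \<in> carrier G" "w \<in> carrier G"
  shows "(\<lambda>g. (\<phi> (g \<otimes> v) - \<phi> (g \<otimes> w))\<^sup>2) summable_on carrier G"
proof (rule summable_on_comparison_test)
  show "(\<lambda>g. 2 * (\<phi> (g \<otimes> v))\<^sup>2 + 2 * (\<phi> (g \<otimes> w))\<^sup>2) summable_on carrier G"
    using assms by (intro summable_on_add summable_on_cmult_right translate_summable)
qed (use power2_diff_le[of _ _ 0] in auto)

lemma energy_summable': "w \<in> carrier G \<Longrightarrow> (\<lambda>g. (\<phi> g - \<phi> (g \<otimes> w))\<^sup>2) summable_on carrier G"
  using energy_summable[of \<one> w] by (simp cong: summable_on_cong)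

text \<open>The triangle inequality for squares, through the intermediate translate by
  \<open>v\<close>; right translation by \<open>v\<close> preserves the sum and turns the second
  part into the energy of \<open>w\<close>.\<close>

lemma energy_mult:
  assumes v: "v \<in> carrier G" and w: "w \<in> carrier G"
  shows "energy \<phi> (v \<otimes> w) \<le> 2 * energy \<phi> v + 2 * energy \<phi> w"
proof -
  have s: "(\<lambda>g. (\<phi> (g \<otimes> v) - \<phi> (g \<otimes> (v \<otimes> w)))\<^sup>2) summable_on carrier G"
    using energy_summable v w by simp
  have "energy \<phi> (v \<otimes> w) \<le>
      (\<Sum>\<^sub>\<infinity>g\<in>carrier G. 2 * (\<phi> g - \<phi> (g \<otimes> v))\<^sup>2 + 2 * (\<phi> (g \<otimes> v) - \<phi> (g \<otimes> (v \<otimes> w)))\<^sup>2)"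
    unfolding energy_def using v w s
    by (intro infsum_mono summable_on_add summable_on_cmult_right energy_summable' power2_diff_le) auto
  also have "\<dots> = 2 * energy \<phi> v + 2 * (\<Sum>\<^sub>\<infinity>g\<in>carrier G. (\<phi> (g \<otimes> v) - \<phi> (g \<otimes> (v \<otimes> w)))\<^sup>2)"
    unfolding energy_def using energy_summable'[OF v] s
    by (simp add: infsum_add infsum_cmult_right' summable_on_cmult_right)
  also have "(\<Sum>\<^sub>\<infinity>g\<in>carrier G. (\<phi> (g \<otimes> v) - \<phi> (g \<otimes> (v \<otimes> w)))\<^sup>2) =
      (\<Sum>\<^sub>\<infinity>g\<in>carrier G. (\<phi> (g \<otimes> v) - \<phi> (g \<otimes> v \<otimes> w))\<^sup>2)"
    using v w by (intro infsum_cong) (simp add: m_assoc)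
  also have "\<dots> = energy \<phi> w"
    unfolding energy_def
    using infsum_reindex_bij_betw[OF right_mult_bij[OF v], of "\<lambda>g. (\<phi> g - \<phi> (g \<otimes> w))\<^sup>2"] by simp
  finally show ?thesis .
qed

lemma energy_nonneg: "0 \<le> energy \<phi> w"
  unfolding energy_def by (intro infsum_nonneg) simp

lemma energy_pow:
  assumes w: "w \<in> carrier G" shows "energy \<phi> (w [^] (n::nat)) \<le> 4 ^ n * energy \<phi> w"
proof (induction n)
  case 0
  have "energy \<phi> \<one> = 0" unfolding energy_def by (intro infsum_0) simp
  then show ?case using energy_nonneg by simp
next
  case (Suc n)
  have "1 * energy \<phi> w \<le> 4 ^ n * energy \<phi> w"
    using energy_nonneg by (intro mult_right_mono) auto
  then show ?case using Suc energy_mult[OF nat_pow_closed[OF w] w, of n] by simp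
qed

text \<open>\<open>X\<close> and its translates by \<open>w\<close> and \<open>w \<otimes> w\<close>
  are disjoint, so their masses add up to at most the total, while each mass is comparable to that
  of \<open>X\<close> up to energy.\<close>

lemma mass_of_wandering_set:
  assumes X: "X \<subseteq> carrier G" and w: "w \<in> carrier G"
    and wandering: "\<And>g. g \<in> X \<Longrightarrow> g \<otimes> w \<notin> X \<and> g \<otimes> w \<otimes> w \<notin> X"
  shows "3 * (\<Sum>\<^sub>\<infinity>g\<in>X. (\<phi> g)\<^sup>2) \<le> 5 / 4 * (\<Sum>\<^sub>\<infinity>g\<in>carrier G. (\<phi> g)\<^sup>2) + 25 * energy \<phi> w"
proof -
  let ?\<nu> = "\<lambda>X. \<Sum>\<^sub>\<infinity>g\<in>X. (\<phi> g)\<^sup>2"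
  have sub: "(\<lambda>g. (\<phi> g)\<^sup>2) summable_on Z" if "Z \<subseteq> carrier G" for Z
    using \<phi> that by (rule summable_on_subset_banach)
  let ?T = "\<lambda>v. (\<lambda>g. g \<otimes> v) ` X"
  have T: "?T v \<subseteq> carrier G" if "v \<in> carrier G" for v using X that by auto
  have shift: "?\<nu> X \<le> 5 / 4 * ?\<nu> (?T v) + 5 * energy \<phi> v" if v: "v \<in> carrier G" for v
  proof -
    have s1: "(\<lambda>g. (\<phi> (g \<otimes> v))\<^sup>2) summable_on X" "(\<lambda>g. (\<phi> g - \<phi> (g \<otimes> v))\<^sup>2) summable_on X"
      using translate_summable[OF v] energy_summable'[OF v] X by (blast intro: summable_on_subset_banach)+
    have "?\<nu> X \<le> (\<Sum>\<^sub>\<infinity>g\<in>X. 5 / 4 * (\<phi> (g \<otimes> v))\<^sup>2 + 5 * (\<phi> g - \<phi> (g \<otimes> v))\<^sup>2)"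
      by (intro infsum_mono power2_le_shifted sub X summable_on_add summable_on_cmult_right s1)
    also have "\<dots> = 5 / 4 * (\<Sum>\<^sub>\<infinity>g\<in>X. (\<phi> (g \<otimes> v))\<^sup>2) + 5 * (\<Sum>\<^sub>\<infinity>g\<in>X. (\<phi> g - \<phi> (g \<otimes> v))\<^sup>2)"
      using s1 by (simp only: infsum_add infsum_cmult_right' summable_on_cmult_right)
    also have "(\<Sum>\<^sub>\<infinity>g\<in>X. (\<phi> (g \<otimes> v))\<^sup>2) = ?\<nu> (?T v)"
      using X v by (subst infsum_reindex) (auto simp: o_def inj_on_def subset_eq)
    also have "(\<Sum>\<^sub>\<infinity>g\<in>X. (\<phi> g - \<phi> (g \<otimes> v))\<^sup>2) \<le> energy \<phi> v"
      unfolding energy_def using X s1 energy_summable'[OF v] by (intro infsum_mono2) auto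
    finally show ?thesis by simp
  qed
  have ww: "w \<otimes> w \<in> carrier G" using w by simp
  have disj: "X \<inter> ?T w = {}" "(X \<union> ?T w) \<inter> ?T (w \<otimes> w) = {}"
  proof -
    have "g \<otimes> w \<noteq> h \<otimes> (w \<otimes> w)" if "g \<in> X" "h \<in> X" for g h
    proof
      assume "g \<otimes> w = h \<otimes> (w \<otimes> w)"
      then have "g = h \<otimes> w" using that X w by (simp add: subset_eq flip: m_assoc)
      with wandering that show False by blast
    qed
    moreover have "g \<otimes> (w \<otimes> w) \<notin> X" if "g \<in> X" for g
      using wandering[OF that] that X w by (simp add: subset_eq m_assoc)
    ultimately show "X \<inter> ?T w = {}" "(X \<union> ?T w) \<inter> ?T (w \<otimes> w) = {}"
      using wandering by blast+
  qed
  have "?\<nu> X + ?\<nu> (?T w) + ?\<nu> (?T (w \<otimes> w)) = ?\<nu> (X \<union> ?T w \<union> ?T (w \<otimes> w))"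
    using X T[OF w] T[OF ww] disj by (simp add: infsum_Un_disjoint sub)
  also have "\<dots> \<le> ?\<nu> (carrier G)"
    using X T[OF w] T[OF ww] by (intro infsum_mono2 sub) auto
  finally have "?\<nu> X + ?\<nu> (?T w) + ?\<nu> (?T (w \<otimes> w)) \<le> ?\<nu> (carrier G)" .
  \<comment> \<open>Allows the untranslated copy of \<open>X\<close> to carry the factor 5/4 as
    well. The energy constant is 5 for \<open>w\<close> plus 5 times 4 for
    \<open>w \<otimes> w\<close>, that is 25.\<close>
  moreover have "0 \<le> ?\<nu> X" by (intro infsum_nonneg) simp
  ultimately show ?thesis
    using shift[OF w] shift[OF ww] energy_mult[OF w w] by linarith
qed

text \<open>Adding the bounds for the two covering sets leaves a sixth of the total mass on the left
  against 25/3 of the energies of the powers, whence 50; passing from \<open>n\<close>-th powers to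
  generators costs \<open>4 ^ n\<close>.\<close>

lemma spectral_gap:
  assumes ab: "a \<in> carrier G" "b \<in> carrier G" and XY: "X \<union> Y = carrier G"
    and X: "\<forall>g\<in>X. g \<otimes> a [^] n \<notin> X \<and> g \<otimes> a [^] n \<otimes> a [^] n \<notin> X"
    and Y: "\<forall>g\<in>Y. g \<otimes> b [^] n \<notin> Y \<and> g \<otimes> b [^] n \<otimes> b [^] n \<notin> Y"
  shows "(\<Sum>\<^sub>\<infinity>g\<in>carrier G. (\<phi> g)\<^sup>2) \<le> 50 * 4 ^ (n::nat) * (energy \<phi> a + energy \<phi> b)"
proof -
  let ?\<nu> = "\<lambda>X. \<Sum>\<^sub>\<infinity>g\<in>X. (\<phi> g)\<^sup>2"
  have sub: "(\<lambda>g. (\<phi> g)\<^sup>2) summable_on Z" if "Z \<subseteq> carrier G" for Z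
    using \<phi> that by (rule summable_on_subset_banach)
  have "?\<nu> (carrier G) = ?\<nu> (X \<union> (Y - X))" using XY by (simp add: Un_Diff_cancel)
  also have "\<dots> = ?\<nu> X + ?\<nu> (Y - X)"
    using XY by (intro infsum_Un_disjoint sub) auto
  also have "?\<nu> (Y - X) \<le> ?\<nu> Y"
    using XY by (intro infsum_mono2 sub) auto
  finally have "?\<nu> (carrier G) \<le> ?\<nu> X + ?\<nu> Y" by simp
  moreover have "3 * ?\<nu> X \<le> 5 / 4 * ?\<nu> (carrier G) + 25 * energy \<phi> (a [^] n)"
    using XY ab X by (intro mass_of_wandering_set) auto
  moreover have "3 * ?\<nu> Y \<le> 5 / 4 * ?\<nu> (carrier G) + 25 * energy \<phi> (b [^] n)"
    using XY ab Y by (intro mass_of_wandering_set) auto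
  ultimately have "?\<nu> (carrier G) \<le> 50 * (energy \<phi> (a [^] n) + energy \<phi> (b [^] n))"
    by argo
  also have "\<dots> \<le> 50 * (4 ^ n * energy \<phi> a + 4 ^ n * energy \<phi> b)"
    using energy_pow[OF ab(1), of n] energy_pow[OF ab(2), of n] by (intro mult_left_mono add_mono) auto
  finally show ?thesis by (simp add: distrib_left)
qed

end

end

section \<open>Translates of a finitely supported chain\<close>

context tree_action
begin

text \<open>The combination of the translates of \<open>r\<close> by the elements
  \<open>\<sigma> j\<close>. The placement \<open>\<sigma>\<close> is kept apart from the
  coefficients because the induced operator changes only the placement.\<close>

definition comb :: "('e \<Rightarrow> complex) \<Rightarrow> ('i \<Rightarrow> 'g) \<Rightarrow> 'i set \<Rightarrow> ('i \<Rightarrow> complex) \<Rightarrow> 'e \<Rightarrow> complex" where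
  "comb r \<sigma> J c = (\<lambda>e. \<Sum>j\<in>J. c j * r (act_e (inv (\<sigma> j)) e))"

lemma comb_reindex:
  assumes "inj_on \<sigma> J"
  shows "comb r \<sigma> J c = comb r id (\<sigma> ` J) (c \<circ> inv_into J \<sigma>)"
  using assms by (auto simp: comb_def fun_eq_iff sum.reindex intro!: sum.cong)

lemma comb_collect:
  assumes "finite J" shows "comb r \<sigma> J c = comb r id (\<sigma> ` J) (\<lambda>g. \<Sum>j\<in>{j \<in> J. \<sigma> j = g}. c j)"
proof
  fix e
  have "comb r \<sigma> J c e = (\<Sum>g\<in>\<sigma> ` J. \<Sum>j\<in>{j \<in> J. \<sigma> j = g}. c j * r (act_e (inv (\<sigma> j)) e))"
    unfolding comb_def by (rule sum.image_gen[OF assms])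
  also have "\<dots> = (\<Sum>g\<in>\<sigma> ` J. (\<Sum>j\<in>{j \<in> J. \<sigma> j = g}. c j) * r (act_e (inv g) e))"
    by (auto simp: sum_distrib_right intro!: sum.cong)
  finally show "comb r \<sigma> J c e = comb r id (\<sigma> ` J) (\<lambda>g. \<Sum>j\<in>{j \<in> J. \<sigma> j = g}. c j) e"
    by (simp add: comb_def)
qed

context
  fixes r :: "'e \<Rightarrow> complex"
  assumes fin: "finite (supp r)"
begin

text \<open>By freeness at most \<open>card (supp r)\<close> translates are nonzero at an edge.
  Cauchy-Schwarz there, followed by exchanging the sums, gives the bound.\<close>

lemma comb_upper:
  fixes \<sigma> :: "'i \<Rightarrow> 'g"
  assumes J: "finite J" "inj_on \<sigma> J" "\<sigma> ` J \<subseteq> carrier G"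
  defines "K \<equiv> sqrt (card (supp r)) * L2_set (\<lambda>e. cmod (r e)) (supp r)"
  shows "sq_summable (comb r \<sigma> J c)" "l2norm (comb r \<sigma> J c) \<le> K * L2_set (\<lambda>j. cmod (c j)) J"
proof -
  let ?t = "\<lambda>j e. r (act_e (inv (\<sigma> j)) e)" and ?S = "supp r"
  have \<sigma>: "\<sigma> j \<in> carrier G" if "j \<in> J" for j using J that by auto
  have pt: "(cmod (comb r \<sigma> J c e))\<^sup>2 \<le> card ?S * (\<Sum>j\<in>J. (cmod (c j))\<^sup>2 * (cmod (?t j e))\<^sup>2)" for e
  proof -
    define I where "I = {j \<in> J. ?t j e \<noteq> 0}"
    have "inj_on (\<lambda>j. act_e (inv (\<sigma> j)) e) I"
    proof (rule inj_onI)
      fix i j assume ij: "i \<in> I" "j \<in> I" "act_e (inv (\<sigma> i)) e = act_e (inv (\<sigma> j)) e"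
      then have "inv (\<sigma> i) = inv (\<sigma> j)" using \<sigma> by (intro act_e_free) (auto simp: I_def)
      then have "inv (inv (\<sigma> i)) = inv (inv (\<sigma> j))" by simp
      then have "\<sigma> i = \<sigma> j" using \<sigma> ij by (simp add: I_def)
      then show "i = j" using J ij by (auto simp: I_def dest: inj_onD)
    qed
    moreover have "(\<lambda>j. act_e (inv (\<sigma> j)) e) ` I \<subseteq> ?S"
      by (auto simp: I_def supp_def)
    ultimately have cI: "card I \<le> card ?S"
      using fin card_inj_on_le by blast
    have "comb r \<sigma> J c e = (\<Sum>j\<in>I. c j * ?t j e)"
      unfolding comb_def using J by (intro sum.mono_neutral_right) (auto simp: I_def)
    then have "cmod (comb r \<sigma> J c e) \<le> (\<Sum>j\<in>I. cmod (c j * ?t j e))"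
      by (simp add: norm_sum)
    then have "(cmod (comb r \<sigma> J c e))\<^sup>2 \<le> (\<Sum>j\<in>I. cmod (c j * ?t j e))\<^sup>2"
      by (intro power_mono) auto
    also have "\<dots> \<le> (\<Sum>j\<in>I. (cmod (c j * ?t j e))\<^sup>2) * card I"
      by (rule sum_squared_le_sum_of_squares)
    also have "\<dots> \<le> (\<Sum>j\<in>J. (cmod (c j * ?t j e))\<^sup>2) * card ?S"
      using J cI by (intro mult_mono sum_mono2 sum_nonneg) (auto simp: I_def)
    finally show ?thesis by (simp add: norm_mult power_mult_distrib mult.commute)
  qed
  have col: "(\<Sum>e\<in>E. (cmod (?t j e))\<^sup>2) \<le> (\<Sum>e\<in>?S. (cmod (r e))\<^sup>2)" if "finite E" "j \<in> J" for E j
  proof -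
    have "inj_on (act_e (inv (\<sigma> j))) E"
      using \<sigma>[OF that(2)] by (auto simp: inj_on_def act_e_cancel)
    then have "(\<Sum>e\<in>E. (cmod (?t j e))\<^sup>2) = (\<Sum>e\<in>act_e (inv (\<sigma> j)) ` E. (cmod (r e))\<^sup>2)"
      by (simp add: sum.reindex)
    also have "\<dots> = (\<Sum>e\<in>act_e (inv (\<sigma> j)) ` E \<inter> ?S. (cmod (r e))\<^sup>2)"
      using that by (intro sum.mono_neutral_right) (auto simp: supp_def)
    also have "\<dots> \<le> (\<Sum>e\<in>?S. (cmod (r e))\<^sup>2)"
      using fin by (intro sum_mono2) auto
    finally show ?thesis .
  qed
  have "L2_set (\<lambda>e. cmod (comb r \<sigma> J c e)) E \<le> K * L2_set (\<lambda>j. cmod (c j)) J" if E: "finite E" for E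
  proof -
    have "(\<Sum>e\<in>E. (cmod (comb r \<sigma> J c e))\<^sup>2) \<le>
        (\<Sum>e\<in>E. card ?S * (\<Sum>j\<in>J. (cmod (c j))\<^sup>2 * (cmod (?t j e))\<^sup>2))"
      by (intro sum_mono pt)
    also have "\<dots> = card ?S * (\<Sum>j\<in>J. (cmod (c j))\<^sup>2 * (\<Sum>e\<in>E. (cmod (?t j e))\<^sup>2))"
      by (simp add: sum_distrib_left sum.swap[of _ J E])
    also have "\<dots> \<le> card ?S * (\<Sum>j\<in>J. (cmod (c j))\<^sup>2 * (\<Sum>e\<in>?S. (cmod (r e))\<^sup>2))"
      using E by (intro mult_left_mono sum_mono col) auto
    also have "\<dots> = card ?S * (\<Sum>e\<in>?S. (cmod (r e))\<^sup>2) * (\<Sum>j\<in>J. (cmod (c j))\<^sup>2)"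
      by (simp only: flip: sum_distrib_right) (simp only: ac_simps)
    finally show ?thesis
      unfolding K_def L2_set_def by (simp flip: real_sqrt_mult)
  qed
  moreover have "0 \<le> K * L2_set (\<lambda>j. cmod (c j)) J" by (simp add: K_def)
  ultimately show "sq_summable (comb r \<sigma> J c)" "l2norm (comb r \<sigma> J c) \<le> K * L2_set (\<lambda>j. cmod (c j)) J"
    using sq_summable_bound[of "K * L2_set (\<lambda>j. cmod (c j)) J" "comb r \<sigma> J c"] by simp_all
qed

text \<open>Every translate of \<open>r\<close> other than the one by \<open>g\<close> vanishes at
  the edge \<open>act_e g e\<close>, so the combination has modulus \<open>cmod (c g)\<close>
  there.\<close>

lemma comb_lower_single_edge:
  assumes J: "finite J" "J \<subseteq> carrier G"
    and e: "cmod (r e) = 1" "\<And>g. g \<in> carrier G \<Longrightarrow> g \<noteq> \<one> \<Longrightarrow> r (act_e g e) = 0"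
  shows "L2_set (\<lambda>g. cmod (c g)) J \<le> l2norm (comb r id J c)"
proof -
  have val: "cmod (comb r id J c (act_e g e)) = cmod (c g)" if "g \<in> J" for g
  proof -
    have z: "r (act_e (inv h) (act_e g e)) = 0" if "h \<in> J - {g}" for h
    proof -
      have hg: "h \<in> carrier G" "g \<in> carrier G" using that \<open>g \<in> J\<close> J by auto
      have "inv h \<otimes> g \<noteq> \<one>"
        using hg that Units_l_cancel[of "inv h" g h] by (auto simp: Units_eq)
      then show ?thesis using e(2)[of "inv h \<otimes> g"] hg by (simp add: act_e_mult)
    qed
    have "comb r id J c (act_e g e) = (\<Sum>h\<in>{g}. c h * r (act_e (inv h) (act_e g e)))"
      unfolding comb_def id_apply using J that z by (intro sum.mono_neutral_right) auto
    then show ?thesis using that J e by (auto simp: norm_mult)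
  qed
  have inj: "inj_on (\<lambda>g. act_e g e) J"
    using J act_e_free by (auto simp: inj_on_def subset_eq)
  have "L2_set (\<lambda>g. cmod (c g)) J = L2_set (\<lambda>e. cmod (comb r id J c e)) ((\<lambda>g. act_e g e) ` J)"
    using inj val by (simp add: L2_set_def sum.reindex)
  also have "\<dots> \<le> l2norm (comb r id J c)"
    using J comb_upper(1)[of J id c] by (intro L2_set_le_l2norm) auto
  finally show ?thesis .
qed

text \<open>The edge \<open>g e\<close> sees only the coefficients of \<open>g\<close> and \<open>g s\<close>, up to factors of modulus one.\<close>

lemma energy_le_comb:
  fixes c :: "'g \<Rightarrow> complex"
  assumes J: "finite J" "J \<subseteq> carrier G" and s: "s \<in> carrier G" "s \<noteq> \<one>"
    and e: "{h \<in> carrier G. r (act_e (inv h) e) \<noteq> 0} = {\<one>, s}"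
      "cmod (r e) = 1" "cmod (r (act_e (inv s) e)) = 1"
  defines "\<phi> \<equiv> \<lambda>g. if g \<in> J then cmod (c g) else 0"
  shows "energy \<phi> s \<le> (l2norm (comb r id J c))\<^sup>2"
proof -
  let ?y = "comb r id J c"
  \<comment> \<open>Extension by zero, since \<open>g\<close> and \<open>g \<otimes> s\<close> may
    lie outside \<open>J\<close>.\<close>
  define d where "d g = (if g \<in> J then c g else 0)" for g
  have val: "\<bar>\<phi> g - \<phi> (g \<otimes> s)\<bar> \<le> cmod (?y (act_e g e))" if g: "g \<in> carrier G" for g
  proof -
    let ?t = "\<lambda>h. r (act_e (inv h) (act_e g e))"
    have gs: "g \<noteq> g \<otimes> s" using g s by simp
    have t0: "?t h = 0" if "h \<in> carrier G" "h \<notin> {g, g \<otimes> s}" for h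
    proof -
      have eq: "?t h = r (act_e (inv (inv g \<otimes> h)) e)"
        using g that by (simp add: inv_mult_group act_e_mult)
      have h: "g \<otimes> (inv g \<otimes> h) = h" using g that by (simp flip: m_assoc)
      have "inv g \<otimes> h \<notin> {\<one>, s}"
      proof
        assume "inv g \<otimes> h \<in> {\<one>, s}"
        then have "g \<otimes> (inv g \<otimes> h) \<in> {g, g \<otimes> s}" using g by auto
        with h that show False by simp
      qed
      then have "r (act_e (inv (inv g \<otimes> h)) e) = 0"
        using e(1) g that(1) by blast
      then show ?thesis using eq by simp
    qed
    have "?y (act_e g e) = (\<Sum>h\<in>J \<union> {g, g \<otimes> s}. d h * ?t h)"
      unfolding comb_def id_apply d_def using J by (intro sum.mono_neutral_cong_left) auto
    also have "\<dots> = (\<Sum>h\<in>{g, g \<otimes> s}. d h * ?t h)"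
      using J t0 by (intro sum.mono_neutral_right) auto
    also have "\<dots> = d g * r e + d (g \<otimes> s) * r (act_e (inv s) e)"
      using g s gs by (simp add: inv_mult_group act_e_mult)
    finally have y: "?y (act_e g e) = d g * r e + d (g \<otimes> s) * r (act_e (inv s) e)" .
    have "\<phi> h = cmod (d h)" for h by (simp add: \<phi>_def d_def)
    \<comment> \<open>The signs at the two places are unknown. Moduli do not see them, and the
      reverse triangle inequality bounds the difference of moduli.\<close>
    then have "\<bar>\<phi> g - \<phi> (g \<otimes> s)\<bar> = \<bar>cmod (d g * r e) - cmod (d (g \<otimes> s) * r (act_e (inv s) e))\<bar>"
      using e by (simp add: norm_mult)
    also have "\<dots> \<le> cmod (?y (act_e g e))"
      using norm_triangle_ineq3[of "d g * r e" "- (d (g \<otimes> s) * r (act_e (inv s) e))"]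
      by (simp add: y)
    finally show ?thesis .
  qed
  show ?thesis
    unfolding energy_def
  proof (rule infsum_le_finite_sums)
    have "(\<lambda>g. (\<phi> g)\<^sup>2) summable_on carrier G"
      using J by (subst summable_on_cong_neutral[where T = J]) (auto simp: \<phi>_def)
    then show "(\<lambda>g. (\<phi> g - \<phi> (g \<otimes> s))\<^sup>2) summable_on carrier G"
      by (rule energy_summable'[OF _ s(1)])
    fix F assume F: "finite F" "F \<subseteq> carrier G"
    have inj: "inj_on (\<lambda>g. act_e g e) F"
      using F act_e_free by (auto simp: inj_on_def subset_eq)
    have "(\<Sum>g\<in>F. (\<phi> g - \<phi> (g \<otimes> s))\<^sup>2) \<le> (\<Sum>g\<in>F. (cmod (?y (act_e g e)))\<^sup>2)"
      using F val by (intro sum_mono) (metis abs_ge_zero power2_abs power_mono subsetD)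
    also have "\<dots> = (L2_set (\<lambda>e. cmod (?y e)) ((\<lambda>g. act_e g e) ` F))\<^sup>2"
      using inj by (simp add: L2_set_def sum.reindex sum_nonneg)
    also have "\<dots> \<le> (l2norm ?y)\<^sup>2"
      using F J comb_upper(1)[of J id c] by (intro power_mono L2_set_le_l2norm) auto
    finally show "(\<Sum>g\<in>F. (\<phi> g - \<phi> (g \<otimes> s))\<^sup>2) \<le> (l2norm ?y)\<^sup>2" .
  qed
qed

text \<open>The squared norm dominates the energy of the moduli of the coefficients in the
  directions \<open>a\<close> and \<open>b\<close>, and the spectral gap turns this into control of
  the coefficients.\<close>

lemma comb_lower_noncommuting:
  assumes ab: "a \<in> carrier G" "b \<in> carrier G" "a \<otimes> b \<noteq> b \<otimes> a"
    and e: "{h \<in> carrier G. r (act_e (inv h) e) \<noteq> 0} = {\<one>, a}"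
      "cmod (r e) = 1" "cmod (r (act_e (inv a) e)) = 1"
    and e': "{h \<in> carrier G. r (act_e (inv h) e') \<noteq> 0} = {\<one>, b}"
      "cmod (r e') = 1" "cmod (r (act_e (inv b) e')) = 1"
  shows "\<exists>L. \<forall>J c. finite J \<longrightarrow> J \<subseteq> carrier G \<longrightarrow>
      L2_set (\<lambda>g. cmod (c g)) J \<le> L * l2norm (comb r id J c)"
proof -
  obtain X Y and n :: nat where XY: "X \<union> Y = carrier G"
    "\<forall>g\<in>X. g \<otimes> a [^] n \<notin> X \<and> g \<otimes> a [^] n \<otimes> a [^] n \<notin> X"
    "\<forall>g\<in>Y. g \<otimes> b [^] n \<notin> Y \<and> g \<otimes> b [^] n \<otimes> b [^] n \<notin> Y"
    using noncommuting_covering[OF ab] by metis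
  have ne: "a \<noteq> \<one>" "b \<noteq> \<one>" using ab by auto
  have "L2_set (\<lambda>g. cmod (c g)) J \<le> sqrt (100 * 4 ^ n) * l2norm (comb r id J c)"
    if J: "finite J" "J \<subseteq> carrier G" for J c
  proof -
    define Y where "Y = (l2norm (comb r id J c))\<^sup>2"
    define \<phi> where "\<phi> g = (if g \<in> J then cmod (c g) else 0)" for g
    have E: "energy \<phi> a \<le> Y" "energy \<phi> b \<le> Y"
      using energy_le_comb[OF J ab(1) ne(1) e, of c] energy_le_comb[OF J ab(2) ne(2) e', of c]
      unfolding \<phi>_def Y_def by simp_all
    have "(\<lambda>g. (\<phi> g)\<^sup>2) summable_on carrier G"
      using J by (subst summable_on_cong_neutral[where T = J]) (auto simp: \<phi>_def)
    from spectral_gap[OF this ab(1,2) XY]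
    have "(\<Sum>\<^sub>\<infinity>g\<in>carrier G. (\<phi> g)\<^sup>2) \<le> 50 * 4 ^ n * (energy \<phi> a + energy \<phi> b)"
      by simp
    also have "\<dots> \<le> 50 * 4 ^ n * (Y + Y)"
      using E by (intro mult_left_mono add_mono) auto
    also have "(\<Sum>\<^sub>\<infinity>g\<in>carrier G. (\<phi> g)\<^sup>2) = (\<Sum>\<^sub>\<infinity>g\<in>J. (cmod (c g))\<^sup>2)"
      using J by (intro infsum_cong_neutral) (auto simp: \<phi>_def)
    also have "\<dots> = (\<Sum>g\<in>J. (cmod (c g))\<^sup>2)" using J by simp
    finally have "(\<Sum>g\<in>J. (cmod (c g))\<^sup>2) \<le> 100 * 4 ^ n * Y" by simp
    then have "sqrt (\<Sum>g\<in>J. (cmod (c g))\<^sup>2) \<le> sqrt (100 * 4 ^ n * Y)"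
      by (rule real_sqrt_le_mono)
    then show ?thesis
      unfolding L2_set_def by (simp add: real_sqrt_mult Y_def)
  qed
  then show ?thesis by blast
qed

text \<open>The norm of the coefficients does not depend on their placement and is comparable to the
  norm of the combination for every injective placement. This makes the constant uniform.\<close>

lemma comb_norm_equivalence:
  assumes L: "\<forall>J c. finite J \<longrightarrow> J \<subseteq> carrier G \<longrightarrow>
      L2_set (\<lambda>g. cmod (c g)) J \<le> L * l2norm (comb r id J c)"
  shows "\<exists>C>0. \<forall>(J :: 'i set) \<sigma> \<tau> c. finite J \<longrightarrow> inj_on \<sigma> J \<longrightarrow> \<sigma> ` J \<subseteq> carrier G \<longrightarrow>
    inj_on \<tau> J \<longrightarrow> \<tau> ` J \<subseteq> carrier G \<longrightarrow> l2norm (comb r \<sigma> J c) \<le> C * l2norm (comb r \<tau> J c)"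
proof -
  define K where "K = sqrt (card (supp r)) * L2_set (\<lambda>e. cmod (r e)) (supp r)"
  have K: "0 \<le> K" by (simp add: K_def)
  \<comment> \<open>The summand 1 only makes the constant positive.\<close>
  have "l2norm (comb r \<sigma> J c) \<le> (K * \<bar>L\<bar> + 1) * l2norm (comb r \<tau> J c)"
    if J: "finite J" "inj_on \<sigma> J" "\<sigma> ` J \<subseteq> carrier G" "inj_on \<tau> J" "\<tau> ` J \<subseteq> carrier G"
    for J :: "'i set" and \<sigma> \<tau> c
  proof -
    have "l2norm (comb r \<sigma> J c) \<le> K * L2_set (\<lambda>j. cmod (c j)) J"
      unfolding K_def by (rule comb_upper(2)[OF J(1-3)])
    also have "L2_set (\<lambda>j. cmod (c j)) J = L2_set (\<lambda>g. cmod ((c \<circ> inv_into J \<tau>) g)) (\<tau> ` J)"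
      using J(4) by (simp add: L2_set_def sum.reindex)
    also have "\<dots> \<le> L * l2norm (comb r \<tau> J c)"
      unfolding comb_reindex[OF J(4)] by (intro L[rule_format]) (use J in auto)
    also have "\<dots> \<le> \<bar>L\<bar> * l2norm (comb r \<tau> J c)"
      by (intro mult_right_mono) auto
    finally have "l2norm (comb r \<sigma> J c) \<le> K * (\<bar>L\<bar> * l2norm (comb r \<tau> J c))"
      using K by (simp add: mult_left_mono)
    then show ?thesis
      using l2norm_nonneg[of "comb r \<tau> J c"] by (simp only: distrib_right mult.assoc mult_1)
  qed
  moreover have "0 < K * \<bar>L\<bar> + 1" using K by (simp add: add_nonneg_pos)
  ultimately show ?thesis
    by (intro exI[of _ "K * \<bar>L\<bar> + 1"] conjI allI impI)
qed

end

end

section \<open>The induced operator on Nielsen chains\<close>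

lemma A2_fH_diff:
  "A2_fH src tgt fv HE (\<lambda>e. x e - y e) = (\<lambda>e. A2_fH src tgt fv HE x e - A2_fH src tgt fv HE y e)"
  by (simp add: A2_fH_def fun_eq_iff left_diff_distrib sum_subtractf)

lemma A2_fH_sum:
  "A2_fH src tgt fv HE (\<lambda>e. \<Sum>j\<in>J. c j * x j e) = (\<lambda>e. \<Sum>j\<in>J. c j * A2_fH src tgt fv HE (x j) e)"
  by (simp add: A2_fH_def fun_eq_iff sum_distrib_left sum_distrib_right mult.assoc sum.swap[of _ J])

text \<open>A coordinate is a sum over an index set independent of the chain: a finite sum, or 0 by
  convention if the set is infinite. Pointwise convergence is thus enough.\<close>

lemma A2_fH_tendsto:
  assumes "\<And>e. (\<lambda>n. x n e) \<longlonglongrightarrow> z e"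
  shows "(\<lambda>n. A2_fH src tgt fv HE (x n) e) \<longlonglongrightarrow> A2_fH src tgt fv HE z e"
  unfolding A2_fH_def by (auto intro!: tendsto_intros assms)

lemma A2_fH_pow_diff:
  "(A2_fH src tgt fv HE ^^ k) (\<lambda>e. x e - y e) =
    (\<lambda>e. (A2_fH src tgt fv HE ^^ k) x e - (A2_fH src tgt fv HE ^^ k) y e)"
  by (induction k) (simp_all add: A2_fH_diff)

lemma A2_fH_pow_tendsto:
  assumes "\<And>e. (\<lambda>n. x n e) \<longlonglongrightarrow> z e"
  shows "(\<lambda>n. (A2_fH src tgt fv HE ^^ k) (x n) e) \<longlonglongrightarrow> (A2_fH src tgt fv HE ^^ k) z e"
  by (induction k arbitrary: e) (simp_all add: A2_fH_tendsto assms)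

definition coeff :: "('e \<Rightarrow> rat) \<Rightarrow> 'e \<Rightarrow> complex" where
  "coeff x e = of_real (real_of_rat (x e))"

lemma coeff_eq_0_iff: "coeff x e = 0 \<longleftrightarrow> x e = 0"
  by (simp add: coeff_def)

locale tree_lift = tree_action src tgt G act_v act_e
  for src tgt :: "'e \<Rightarrow> 'v" and G :: "'g monoid" (structure)
    and act_v :: "'g \<Rightarrow> 'v \<Rightarrow> 'v" and act_e :: "'g \<Rightarrow> 'e \<Rightarrow> 'e" +
  fixes fv :: "'v \<Rightarrow> 'v" and Phi :: "'g \<Rightarrow> 'g" and HV :: "'v set" and HE :: "'e set"
  assumes standing: "standing_setup G act_v act_e src tgt fv Phi HV HE"
begin

abbreviation pc :: "'v \<Rightarrow> 'v \<Rightarrow> 'e \<Rightarrow> int" where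
  "pc \<equiv> path_chain src tgt"

abbreviation m :: "'e \<Rightarrow> 'e \<Rightarrow> int" where
  "m e \<equiv> pc (fv (src e)) (fv (tgt e))"

abbreviation A2 :: "('e \<Rightarrow> complex) \<Rightarrow> 'e \<Rightarrow> complex" where
  "A2 \<equiv> A2_fH src tgt fv HE"

lemma Phi_bij: "bij_betw Phi (carrier G) (carrier G)"
  using standing by (auto simp: standing_setup_def iso_def)

lemma Phi_closed [simp]: "g \<in> carrier G \<Longrightarrow> Phi g \<in> carrier G"
  using Phi_bij bij_betwE by blast

lemma fv_act: "g \<in> carrier G \<Longrightarrow> fv (act_v g z) = act_v (Phi g) (fv z)"
  using standing by (simp add: standing_setup_def)

lemma act_e_HE: "g \<in> carrier G \<Longrightarrow> e \<in> HE \<Longrightarrow> act_e g e \<in> HE"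
  using standing unfolding standing_setup_def by (elim conjE) blast

lemma act_e_inv_HE_iff: "g \<in> carrier G \<Longrightarrow> act_e (inv g) e \<in> HE \<longleftrightarrow> e \<in> HE"
  using act_e_HE[of g "act_e (inv g) e"] act_e_HE[of "inv g" e] by auto

lemma m_HE: "e \<in> HE \<Longrightarrow> e' \<notin> HE \<Longrightarrow> m e e' = 0"
  using standing unfolding standing_setup_def by blast

lemma m_act: "g \<in> carrier G \<Longrightarrow> m (act_e g e) e' = m e (act_e (inv (Phi g)) e')"
  by (simp add: src_act tgt_act fv_act path_chain_act)

text \<open>There are finitely many edge orbits. Within one, equivariance moves the group element to
  \<open>e'\<close>, and the finite support of the image of a representative, with injectivity of
  \<open>Phi\<close>, leaves finitely many choices. So the coordinate sums in \<open>A2_fH\<close>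
  are genuine.\<close>

lemma finite_column: "finite {e. m e e' \<noteq> 0}"
proof -
  obtain R where R: "finite R" "\<And>e. \<exists>g\<in>carrier G. \<exists>d\<in>R. e = act_e g d"
    using finite_edge_orbits by blast
  let ?I = "\<lambda>d. {g \<in> carrier G. m d (act_e (inv (Phi g)) e') \<noteq> 0}"
  have "finite (?I d)" for d
  proof (rule inj_on_finite)
    show "(\<lambda>g. act_e (inv (Phi g)) e') ` ?I d \<subseteq> supp (m d)"
      by (auto simp: supp_def)
    show "inj_on (\<lambda>g. act_e (inv (Phi g)) e') (?I d)"
    proof (rule inj_onI)
      fix g h assume gh: "g \<in> ?I d" "h \<in> ?I d" "act_e (inv (Phi g)) e' = act_e (inv (Phi h)) e'"
      then have "inv (Phi g) = inv (Phi h)" by (intro act_e_free) auto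
      then have "inv (inv (Phi g)) = inv (inv (Phi h))" by simp
      then have "Phi g = Phi h" using gh by simp
      then show "g = h" using Phi_bij gh by (auto simp: bij_betw_def dest: inj_onD)
    qed
  qed (rule finite_supp_path_chain)
  then have "finite (\<Union>d\<in>R. (\<lambda>g. act_e g d) ` ?I d)" using R by blast
  moreover have "{e. m e e' \<noteq> 0} \<subseteq> (\<Union>d\<in>R. (\<lambda>g. act_e g d) ` ?I d)"
  proof
    fix e assume e: "e \<in> {e. m e e' \<noteq> 0}"
    obtain g d where "g \<in> carrier G" "d \<in> R" "e = act_e g d" using R by blast
    with e show "e \<in> (\<Union>d\<in>R. (\<lambda>g. act_e g d) ` ?I d)" by (auto simp: m_act)
  qed
  ultimately show ?thesis by (rule rev_finite_subset)
qed

text \<open>The operator of the lift, before projection, sends \<open>[u,v]\<close> to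
  \<open>[fv u, fv v]\<close>: true for one edge by definition of \<open>m\<close>, then additive
  along a walk.\<close>

lemma sum_column_path_chain: "(\<Sum>e | m e e' \<noteq> 0. pc u v e * m e e') = pc (fv u) (fv v) e'"
proof -
  obtain p where "wlk u p v" by (rule ex_path)
  then show ?thesis
  proof (induction p arbitrary: u)
    case (Cons x p)
    have edge: "(\<Sum>e | m e e' \<noteq> 0. pc (src d) (tgt d) e * m e e') = m d e'" for d
    proof -
      have "(\<Sum>e | m e e' \<noteq> 0. pc (src d) (tgt d) e * m e e') = (\<Sum>e | m e e' \<noteq> 0. if e = d then m e e' else 0)"
        by (intro sum.cong) (auto simp: path_chain_edge)
      also have "\<dots> = m d e'"
        using finite_column[of e'] by (simp add: sum.delta)
      finally show ?thesis .
    qed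
    have x: "(\<Sum>e | m e e' \<noteq> 0. pc (orig x) (dest x) e * m e e') = pc (fv (orig x)) (fv (dest x)) e'"
    proof (cases "snd x")
      case True
      then show ?thesis using edge[of "fst x"] by (simp add: orig_def dest_def)
    next
      case False
      have "(\<Sum>e | m e e' \<noteq> 0. pc (orig x) (dest x) e * m e e') =
          - (\<Sum>e | m e e' \<noteq> 0. pc (src (fst x)) (tgt (fst x)) e * m e e')"
        using False path_chain_flip[of "tgt (fst x)" "src (fst x)"]
        by (simp add: orig_def dest_def sum_negf)
      then show ?thesis
        using False edge[of "fst x"] path_chain_flip[of "fv (tgt (fst x))" "fv (src (fst x))"]
        by (simp add: orig_def dest_def)
    qed
    have u: "u = orig x" and p: "wlk (dest x) p v" using Cons.prems by (auto simp: walk_Cons)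
    show ?case
      unfolding u path_chain_add[of "orig x" v _ "dest x"]
        path_chain_add[of "fv (orig x)" "fv v" _ "fv (dest x)"]
      using x Cons.IH[OF p] by (simp add: distrib_right sum.distrib)
  qed simp
qed

section \<open>Nielsen chains between vertices fixed by the lift\<close>

context
  fixes u v :: 'v and \<rho> :: "'e \<Rightarrow> rat"
  assumes fixed: "fv u = u" "fv v = v"
    and \<rho>: "\<rho> = proj_H HE (\<lambda>e. of_int (pc u v e))"
begin

lemma coeff_chain: "coeff \<rho> e = (if e \<in> HE then 0 else of_int (pc u v e))"
  by (simp add: coeff_def \<rho> proj_H_def)

text \<open>The translate by \<open>g\<close> of \<open>[u,v]\<close> joins \<open>g u\<close> to
  \<open>g v\<close>. The lift sends these to \<open>Phi g\<close> applied to \<open>u\<close> and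
  \<open>v\<close>, since both are fixed.\<close>

lemma A2_translate:
  assumes g: "g \<in> carrier G"
  shows "A2 (\<lambda>e. coeff \<rho> (act_e (inv g) e)) = (\<lambda>e. coeff \<rho> (act_e (inv (Phi g)) e))"
proof
  fix e'
  show "A2 (\<lambda>e. coeff \<rho> (act_e (inv g) e)) e' = coeff \<rho> (act_e (inv (Phi g)) e')"
  proof (cases "e' \<in> HE")
    case True
    then show ?thesis using g by (simp add: A2_fH_def coeff_chain act_e_inv_HE_iff)
  next
    case False
    \<comment> \<open>The projection may be dropped inside the sum: by invariance of
      \<open>H\<close>, edges of \<open>HE\<close> contribute nothing to an edge outside
      \<open>HE\<close>.\<close>
    have "A2 (\<lambda>e. coeff \<rho> (act_e (inv g) e)) e' =
        (\<Sum>e | m e e' \<noteq> 0. of_int (pc (act_v g u) (act_v g v) e * m e e'))"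
      using False g m_HE
      by (auto simp: A2_fH_def coeff_chain act_e_inv_HE_iff path_chain_act intro!: sum.cong)
    also have "\<dots> = of_int (pc (fv (act_v g u)) (fv (act_v g v)) e')"
      by (simp only: sum_column_path_chain flip: of_int_sum)
    also have "\<dots> = coeff \<rho> (act_e (inv (Phi g)) e')"
      using g False by (simp add: coeff_chain act_e_inv_HE_iff path_chain_act fv_act fixed)
    finally show ?thesis .
  qed
qed

lemma A2_comb:
  assumes "\<sigma> ` J \<subseteq> carrier G"
  shows "A2 (comb (coeff \<rho>) \<sigma> J c) = comb (coeff \<rho>) (Phi \<circ> \<sigma>) J c"
  unfolding comb_def A2_fH_sum
  using assms by (intro ext sum.cong refl) (auto simp: A2_translate)

lemma A2_pow_comb:
  assumes J: "J \<subseteq> carrier G"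
  shows "(A2 ^^ k) (comb (coeff \<rho>) id J c) = comb (coeff \<rho>) (Phi ^^ k) J c \<and>
    bij_betw (Phi ^^ k) (carrier G) (carrier G)"
proof (induction k)
  case 0
  have "bij_betw (Phi ^^ 0) (carrier G) (carrier G)" using bij_betw_id by simp
  then show ?case by (simp add: id_def)
next
  case (Suc k)
  then have "(Phi ^^ k) ` J \<subseteq> carrier G" using J by (auto simp: bij_betw_def)
  with Suc show ?case
    using A2_comb[of "Phi ^^ k" J c] bij_betw_trans[OF _ Phi_bij] by (auto simp: comp_def)
qed

lemma finite_supp_coeff: "finite (supp (coeff \<rho>))"
  by (rule finite_subset[OF _ finite_supp_path_chain[of u v]]) (auto simp: supp_def coeff_chain)

lemma cmod_coeff: "coeff \<rho> e \<noteq> 0 \<Longrightarrow> cmod (coeff \<rho> e) = 1"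
  using path_chain_values[of u v e] by (auto simp: coeff_chain split: if_splits)

text \<open>An edge common to \<open>\<rho>\<close> and its translate by \<open>s\<close> already
  lies in two translates, and by GNC2 it lies in no others.\<close>

lemma geometric_edge:
  assumes s: "s \<in> carrier G" "s \<noteq> \<one>" "supp \<rho> \<inter> supp (chain_act G act_e s \<rho>) \<noteq> {}"
    and gnc2: "GNC2 G act_e HE \<rho>"
  shows "\<exists>e. {h \<in> carrier G. coeff \<rho> (act_e (inv h) e) \<noteq> 0} = {\<one>, s} \<and>
    cmod (coeff \<rho> e) = 1 \<and> cmod (coeff \<rho> (act_e (inv s) e)) = 1"
proof -
  obtain e where e: "\<rho> e \<noteq> 0" "\<rho> (act_e (inv s) e) \<noteq> 0"
    using s(3) by (auto simp: supp_def chain_act_def)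
  then have "e \<notin> HE" by (auto simp: \<rho> proj_H_def)
  then obtain g1 g2 where g: "{g \<in> carrier G. e \<in> supp (chain_act G act_e g \<rho>)} = {g1, g2}"
    using gnc2 unfolding GNC2_def by metis
  have eq: "{h \<in> carrier G. coeff \<rho> (act_e (inv h) e) \<noteq> 0} = {g1, g2}"
    using g by (simp add: supp_def chain_act_def coeff_eq_0_iff)
  moreover have "{\<one>, s} \<subseteq> {h \<in> carrier G. coeff \<rho> (act_e (inv h) e) \<noteq> 0}"
    using e s by (auto simp: coeff_eq_0_iff)
  ultimately have "{h \<in> carrier G. coeff \<rho> (act_e (inv h) e) \<noteq> 0} = {\<one>, s}"
    using s(2) by auto
  moreover have "cmod (coeff \<rho> e) = 1" "cmod (coeff \<rho> (act_e (inv s) e)) = 1"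
    using e by (auto intro!: cmod_coeff simp: coeff_eq_0_iff)
  ultimately show ?thesis by blast
qed

lemma nielsen_lower_bound:
  assumes "NNC1 G act_e HE \<rho> \<or> GNC1 G act_e \<rho> \<and> GNC2 G act_e HE \<rho> \<and> GNC3 G act_e \<rho>"
  shows "\<exists>L. \<forall>J c. finite J \<longrightarrow> J \<subseteq> carrier G \<longrightarrow>
    L2_set (\<lambda>g. cmod (c g)) J \<le> L * l2norm (comb (coeff \<rho>) id J c)"
  using assms
proof (elim disjE conjE)
  assume "NNC1 G act_e HE \<rho>"
  then obtain e where e: "\<rho> e = 1 \<or> \<rho> e = -1" "\<And>g. g \<in> carrier G \<Longrightarrow> g \<noteq> \<one> \<Longrightarrow> \<rho> (act_e g e) = 0"
    unfolding NNC1_def by blast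
  have "cmod (coeff \<rho> e) = 1" using e(1) by (auto intro!: cmod_coeff simp: coeff_eq_0_iff)
  moreover have "coeff \<rho> (act_e g e) = 0" if "g \<in> carrier G" "g \<noteq> \<one>" for g
    using e(2)[OF that] by (simp add: coeff_eq_0_iff)
  ultimately have "L2_set (\<lambda>g. cmod (c g)) J \<le> l2norm (comb (coeff \<rho>) id J c)"
    if "finite J" "J \<subseteq> carrier G" for J c
    by (rule comb_lower_single_edge[OF finite_supp_coeff that])
  then show ?thesis by (intro exI[of _ 1]) simp
next
  assume gnc: "GNC2 G act_e HE \<rho>" "GNC3 G act_e \<rho>"
  obtain a b where ab: "a \<in> carrier G" "b \<in> carrier G" "a \<otimes> b \<noteq> b \<otimes> a"
    "supp \<rho> \<inter> supp (chain_act G act_e a \<rho>) \<noteq> {}" "supp \<rho> \<inter> supp (chain_act G act_e b \<rho>) \<noteq> {}"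
    using gnc(2) unfolding GNC3_def by blast
  have ne: "a \<noteq> \<one>" "b \<noteq> \<one>" using ab by auto
  obtain e e' where
    "{h \<in> carrier G. coeff \<rho> (act_e (inv h) e) \<noteq> 0} = {\<one>, a}"
    "cmod (coeff \<rho> e) = 1" "cmod (coeff \<rho> (act_e (inv a) e)) = 1"
    "{h \<in> carrier G. coeff \<rho> (act_e (inv h) e') \<noteq> 0} = {\<one>, b}"
    "cmod (coeff \<rho> e') = 1" "cmod (coeff \<rho> (act_e (inv b) e')) = 1"
    using geometric_edge[OF ab(1) ne(1) ab(4) gnc(1)] geometric_edge[OF ab(2) ne(2) ab(5) gnc(1)]
    by blast
  then show ?thesis by (rule comb_lower_noncommuting[OF finite_supp_coeff ab(1-3)])
qed

end

end

section \<open>Complex spans\<close>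

lemma complex_span_chains_diff:
  assumes "x \<in> complex_span_chains V" "y \<in> complex_span_chains V"
  shows "(\<lambda>e. x e - y e) \<in> complex_span_chains V"
proof -
  obtain S c where x: "x = (\<lambda>e. \<Sum>z\<in>S. c z * of_real (real_of_rat (z e)))" "finite S" "S \<subseteq> V"
    using assms(1) by (auto simp: complex_span_chains_def)
  obtain T d where y: "y = (\<lambda>e. \<Sum>z\<in>T. d z * of_real (real_of_rat (z e)))" "finite T" "T \<subseteq> V"
    using assms(2) by (auto simp: complex_span_chains_def)
  define b where "b z = (if z \<in> S then c z else 0) - (if z \<in> T then d z else 0)" for z
  have "(\<lambda>e. x e - y e) = (\<lambda>e. \<Sum>z\<in>S \<union> T. b z * of_real (real_of_rat (z e)))"
  proof
    fix e
    have "x e = (\<Sum>z\<in>S \<union> T. (if z \<in> S then c z else 0) * of_real (real_of_rat (z e)))"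
      unfolding x(1) using x y by (intro sum.mono_neutral_cong_left) auto
    moreover have "y e = (\<Sum>z\<in>S \<union> T. (if z \<in> T then d z else 0) * of_real (real_of_rat (z e)))"
      unfolding y(1) using x y by (intro sum.mono_neutral_cong_left) auto
    ultimately show "x e - y e = (\<Sum>z\<in>S \<union> T. b z * of_real (real_of_rat (z e)))"
      by (simp add: b_def left_diff_distrib sum_subtractf)
  qed
  with x y show ?thesis unfolding complex_span_chains_def by blast
qed

section \<open>Norm comparison on the complex span\<close>

context tree_lift
begin

text \<open>Each chain in the span is expanded by its own representation, indexed by pairs of a
  chain and a position; coefficients of equal group elements are then collected by
  \<open>comb_collect\<close>.\<close>

lemma complex_span_comb:
  assumes V: "\<forall>x\<in>V. \<exists>r::nat. \<exists>q gs. (\<forall>j<r. gs j \<in> carrier G) \<and>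
      x = (\<lambda>e. \<Sum>j<r. q j * chain_act G act_e (gs j) \<rho> e)"
    and y: "y \<in> complex_span_chains V"
  shows "\<exists>J c. finite J \<and> J \<subseteq> carrier G \<and> y = comb (coeff \<rho>) id J c"
proof -
  obtain r where "\<forall>x\<in>V. \<exists>q gs. (\<forall>j<(r x::nat). gs j \<in> carrier G) \<and>
      x = (\<lambda>e. \<Sum>j<r x. q j * chain_act G act_e (gs j) \<rho> e)"
    using bchoice[OF V] by (elim exE) (rule that)
  from bchoice[OF this] obtain q where "\<forall>x\<in>V. \<exists>gs. (\<forall>j<r x. gs j \<in> carrier G) \<and>
      x = (\<lambda>e. \<Sum>j<r x. q x j * chain_act G act_e (gs j) \<rho> e)"
    by (elim exE) (rule that)
  from bchoice[OF this] obtain gs where V': "\<forall>x\<in>V. (\<forall>j<r x. gs x j \<in> carrier G) \<and>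
      x = (\<lambda>e. \<Sum>j<r x. q x j * chain_act G act_e (gs x j) \<rho> e)"
    by (elim exE) (rule that)
  obtain S b where S: "y = (\<lambda>e. \<Sum>x\<in>S. b x * of_real (real_of_rat (x e)))" "finite S" "S \<subseteq> V"
    using y by (auto simp: complex_span_chains_def)
  let ?P = "SIGMA x:S. {..<r x}"
  let ?c = "\<lambda>(x, j). b x * of_real (real_of_rat (q x j))"
  let ?\<sigma> = "\<lambda>(x, j). gs x j"
  have "y = comb (coeff \<rho>) ?\<sigma> ?P ?c"
  proof
    fix e
    have "of_real (real_of_rat (x e)) =
        (\<Sum>j<r x. of_real (real_of_rat (q x j)) * coeff \<rho> (act_e (inv (gs x j)) e))" if "x \<in> S" for x
    proof -
      have "x e = (\<Sum>j<r x. q x j * \<rho> (act_e (inv (gs x j)) e))"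
        using V'[THEN bspec, of x, THEN conjunct2, THEN fun_cong, of e] that S
        by (simp add: chain_act_def subset_eq)
      then show ?thesis by (simp add: coeff_def of_rat_sum of_rat_mult)
    qed
    then show "y e = comb (coeff \<rho>) ?\<sigma> ?P ?c e"
      using S by (simp add: comb_def sum_distrib_left mult.assoc sum.Sigma split_def)
  qed
  moreover have "finite ?P" using S by simp
  moreover have "?\<sigma> ` ?P \<subseteq> carrier G" using V' S by fastforce
  ultimately show ?thesis using comb_collect[of ?P "coeff \<rho>" ?\<sigma> ?c]
    by (intro exI[of _ "?\<sigma> ` ?P"] exI conjI finite_imageI) simp_all
qed

text \<open>\<open>y\<close> and its image under the \<open>k\<close>-th power have the same
  coefficients, placed by \<open>id\<close> and by \<open>Phi ^^ k\<close>. The comparison is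
  uniform over injective placements, so \<open>C\<close> is independent of \<open>k\<close>.\<close>

lemma nielsen_span_norm_equivalence:
  assumes \<rho>: "nielsen_chain G act_e src tgt fv HE \<rho>"
    and V: "\<forall>x\<in>V. \<exists>r::nat. \<exists>q gs. (\<forall>j<r. gs j \<in> carrier G) \<and>
      x = (\<lambda>e. \<Sum>j<r. q j * chain_act G act_e (gs j) \<rho> e)"
  shows "\<exists>C>0. \<forall>y\<in>complex_span_chains V. \<forall>k. sq_summable y \<and> sq_summable ((A2 ^^ k) y) \<and>
    l2norm y \<le> C * l2norm ((A2 ^^ k) y) \<and> l2norm ((A2 ^^ k) y) \<le> C * l2norm y"
proof -
  obtain u v where uv: "fv u = u" "fv v = v" "\<rho> = proj_H HE (\<lambda>e. of_int (pc u v e))"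
    and nc: "NNC1 G act_e HE \<rho> \<or> GNC1 G act_e \<rho> \<and> GNC2 G act_e HE \<rho> \<and> GNC3 G act_e \<rho>"
    using \<rho> unfolding nielsen_chain_def by blast
  note fin = finite_supp_coeff[OF uv]
  obtain L where L: "\<forall>J c. finite J \<longrightarrow> J \<subseteq> carrier G \<longrightarrow>
      L2_set (\<lambda>g. cmod (c g)) J \<le> L * l2norm (comb (coeff \<rho>) id J c)"
    using nielsen_lower_bound[OF uv nc] by blast
  obtain C where C: "0 < C" "\<forall>(J :: 'g set) \<sigma> \<tau> c. finite J \<longrightarrow> inj_on \<sigma> J \<longrightarrow> \<sigma> ` J \<subseteq> carrier G \<longrightarrow>
    inj_on \<tau> J \<longrightarrow> \<tau> ` J \<subseteq> carrier G \<longrightarrow>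
    l2norm (comb (coeff \<rho>) \<sigma> J c) \<le> C * l2norm (comb (coeff \<rho>) \<tau> J c)"
    using comb_norm_equivalence[OF fin L] by blast
  have "sq_summable y \<and> sq_summable ((A2 ^^ k) y) \<and>
    l2norm y \<le> C * l2norm ((A2 ^^ k) y) \<and> l2norm ((A2 ^^ k) y) \<le> C * l2norm y"
    if span: "y \<in> complex_span_chains V" for y k
  proof -
    obtain J c where J: "finite J" "J \<subseteq> carrier G" and y: "y = comb (coeff \<rho>) id J c"
      using complex_span_comb[OF V span] by blast
    have Ay: "(A2 ^^ k) y = comb (coeff \<rho>) (Phi ^^ k) J c"
      and bij: "bij_betw (Phi ^^ k) (carrier G) (carrier G)"
      using A2_pow_comb[OF uv J(2)] y by blast+
    have inj: "inj_on (Phi ^^ k) J" "(Phi ^^ k) ` J \<subseteq> carrier G"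
      using bij J(2) by (auto simp: bij_betw_def intro: inj_on_subset)
    have id: "inj_on id J" "id ` J \<subseteq> carrier G" using J by auto
    show ?thesis
      unfolding Ay unfolding y
      using comb_upper(1)[OF fin J(1) id] comb_upper(1)[OF fin J(1) inj]
        C(2)[rule_format, OF J(1) id inj] C(2)[rule_format, OF J(1) inj id] by blast
  qed
  with C(1) show ?thesis by blast
qed

end

theorem theorem5p1:
  fixes G :: "'g monoid"
    and act_v :: "'g \<Rightarrow> 'v \<Rightarrow> 'v" and act_e :: "'g \<Rightarrow> 'e \<Rightarrow> 'e"
    and src tgt :: "'e \<Rightarrow> 'v" and fv :: "'v \<Rightarrow> 'v" and Phi :: "'g \<Rightarrow> 'g"
    and HV :: "'v set" and HE :: "'e set"
    and Vh Vqf :: "('e \<Rightarrow> rat) set"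
  assumes "standing_setup G act_v act_e src tgt fv Phi HV HE"
    and "chain_flare_rel G act_e src tgt fv HE Vh Vqf"
  shows "\<exists>C>0. \<forall>\<xi>\<in>L2_closure HE Vqf. \<forall>k::nat.
           l2norm \<xi> / C \<le> l2norm ((A2_fH src tgt fv HE ^^ k) \<xi>)
         \<and> l2norm ((A2_fH src tgt fv HE ^^ k) \<xi>) \<le> C * l2norm \<xi>"
proof -
  interpret tree_lift src tgt G act_v act_e fv Phi HV HE
    using assms(1) by unfold_locales (simp_all add: standing_setup_def)
  have "\<exists>C>0. \<forall>y\<in>complex_span_chains Vqf. \<forall>k. sq_summable y \<and> sq_summable ((A2 ^^ k) y) \<and>
    l2norm y \<le> C * l2norm ((A2 ^^ k) y) \<and> l2norm ((A2 ^^ k) y) \<le> C * l2norm y"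
  \<comment> \<open>CFH3 provides a Nielsen chain only for nonzero \<open>Vqf\<close>; otherwise the
    span is zero and any positive constant works.\<close>
  proof (cases "Vqf = {\<lambda>_. 0}")
    case True
    have "y = (\<lambda>_. 0)" if "y \<in> complex_span_chains Vqf" for y
      using that True by (fastforce simp: complex_span_chains_def fun_eq_iff intro!: sum.neutral)
    moreover have "(A2 ^^ k) (\<lambda>_. 0) = (\<lambda>_. 0)" for k
      using A2_fH_pow_diff[where x = "\<lambda>_. 0" and y = "\<lambda>_. 0"] by simp
    moreover have "sq_summable (\<lambda>_. 0)" by (simp add: sq_summable_def)
    ultimately show ?thesis by (intro exI[of _ 1]) auto
  next
    case False
    then obtain \<rho> where "nielsen_chain G act_e src tgt fv HE \<rho>"
      "\<forall>x\<in>Vqf. \<exists>r::nat. \<exists>q gs. (\<forall>j<r. gs j \<in> carrier G) \<and>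
        x = (\<lambda>e. \<Sum>j<r. q j * chain_act G act_e (gs j) \<rho> e)"
      using assms(2) unfolding chain_flare_rel_def by blast
    then show ?thesis by (rule nielsen_span_norm_equivalence)
  qed
  then obtain C where C: "0 < C" and W: "\<And>y k. y \<in> complex_span_chains Vqf \<Longrightarrow>
      sq_summable y \<and> sq_summable ((A2 ^^ k) y) \<and>
      l2norm y \<le> C * l2norm ((A2 ^^ k) y) \<and> l2norm ((A2 ^^ k) y) \<le> C * l2norm y"
    by blast
  have "l2norm \<xi> \<le> C * l2norm ((A2 ^^ k) \<xi>) \<and> l2norm ((A2 ^^ k) \<xi>) \<le> C * l2norm \<xi>"
    if \<xi>: "\<xi> \<in> L2_closure HE Vqf" for \<xi> k
  proof -
    have 1: "sq_summable \<xi>"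
      using \<xi> by (simp add: L2_closure_def l2_rel_def sq_summable_def)
    have 2: "\<exists>y\<in>complex_span_chains Vqf. l2norm (\<lambda>e. \<xi> e - y e) < \<epsilon>" if "\<epsilon> > 0" for \<epsilon>
      using \<xi> that by (simp add: L2_closure_def)
    \<comment> \<open>The closure argument is run for the power \<open>A2 ^^ k\<close> itself, so
      the constant is not multiplied with \<open>k\<close>.\<close>
    show ?thesis
      by (intro conjI norm_equivalence_closure[where A = "A2 ^^ k" and W = "complex_span_chains Vqf"
            and C = C and \<xi> = \<xi>])
        (simp_all add: W C 1 2 A2_fH_pow_diff A2_fH_pow_tendsto complex_span_chains_diff)
  qed
  then have "\<forall>\<xi>\<in>L2_closure HE Vqf. \<forall>k. l2norm \<xi> / C \<le> l2norm ((A2 ^^ k) \<xi>) \<and>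
      l2norm ((A2 ^^ k) \<xi>) \<le> C * l2norm \<xi>"
    using C by (simp add: pos_divide_le_eq mult.commute)
  with C show ?thesis by blast
qed

end
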